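(* Let $d\ge2$ be an integer and $0<m_0\le M_0<\infty$. There exists a constant $C_{d,m_0,M_0}>0$, depending only on $d$, $m_0$ and $M_0$, such that for every $n\ge2$ and every distribution $P$ on $[0,1]^d$ with a Lebesgue density $p_0$ satisfying $m_0\le\inf_{x\in[0,1]^d}p_0(x)\le\sup_{x\in[0,1]^d}p_0(x)\le M_0$, \[ \sup_{f_0\in\mathcal{F}_d\cap B_\infty(1)}R(\hat f_n,f_0)\le C_{d,m_0,M_0}\,n^{-1/d}\log^{\gamma_d}n . \]
   Context: $\mathcal{F}_d$ is the class of $f:[0,1]^d\to\mathbb{R}$ with $f(x)\le f(x')$ whenever $x_j\le x_j'$ for all $j=1,\ldots,d$; $B_\infty(1)$ is the set of functions on $[0,1]^d$ with sup-norm at most $1$. $\gamma_2:=9/2$ and $\gamma_d:=(d^2+d+1)/2$ for $d\ge3$. Model: $X_1,\ldots,X_n$ are i.i.d. from $P$, $\epsilon_1,\ldots,\epsilon_n$ are i.i.d. $N(0,1)$ independent of the $X_i$, and $Y_i=f_0(X_i)+\epsilon_i$. The least squares estimator is $\hat f_n\in\arg\min_{f\in\mathcal{F}_d}\sum_{i=1}^n\{Y_i-f(X_i)\}^2$ (its values at $X_1,\ldots,X_n$ are uniquely determined), and $R(\hat f_n,f_0):=\mathbb{E}\bigl[\frac1n\sum_{i=1}^n\{\hat f_n(X_i)-f_0(X_i)\}^2\bigr]$. *)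

theory Defs
  imports "HOL-Probability.Probability"
begin

text \<open>
  The cube \<open>[0,1]\<^sup>d\<close> is the order interval \<open>{0..1}\<close> of \<open>real ^ 'd\<close>, whose order is componentwise.
  A function on the cube is represented by a total function on \<open>real ^ 'd\<close>, of which only the
  values on \<open>{0..1}\<close> are constrained.
\<close>

definition isotonic_funs :: "(real ^ 'd \<Rightarrow> real) set" where
  "isotonic_funs = {f. mono_on {0..1} f}"

definition sup_ball :: "real \<Rightarrow> (real ^ 'd \<Rightarrow> real) set" where
  "sup_ball r = {f. \<forall>x\<in>{0..1}. \<bar>f x\<bar> \<le> r}"

definition log_exponent :: "nat \<Rightarrow> real" where
  "log_exponent d = (if d = 2 then 9/2 else (real d ^ 2 + real d + 1) / 2)"

definition bounded_design :: "real \<Rightarrow> real \<Rightarrow> (real ^ 'd) measure \<Rightarrow> bool" where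
  "bounded_design m M P \<longleftrightarrow> prob_space P \<and>
     (\<exists>p\<in>borel_measurable lborel.
        P = density lborel (\<lambda>x. ennreal (p x) * indicator {0..1} x) \<and>
        (\<forall>x\<in>{0..1}. m \<le> p x \<and> p x \<le> M))"

definition least_squares ::
  "nat \<Rightarrow> (nat \<Rightarrow> real ^ 'd) \<Rightarrow> (nat \<Rightarrow> real) \<Rightarrow> (real ^ 'd \<Rightarrow> real) \<Rightarrow> bool" where
  "least_squares n x y f \<longleftrightarrow>
     is_arg_min (\<lambda>g. \<Sum>i<n. (y i - g (x i))\<^sup>2) (\<lambda>g. g \<in> isotonic_funs) f"

text \<open>
  An estimator maps the design points and the responses to a function. A least squares estimator
  is any selection of minimisers: they all agree at the design points, which is all that the risk
  below depends on. Data with a design point outside the cube are irrelevant (probability zero).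
\<close>

definition lse ::
  "nat \<Rightarrow> ((nat \<Rightarrow> real ^ 'd) \<Rightarrow> (nat \<Rightarrow> real) \<Rightarrow> real ^ 'd \<Rightarrow> real) \<Rightarrow> bool" where
  "lse n fhat \<longleftrightarrow>
     (\<forall>x y. (\<forall>i<n. x i \<in> {0..1}) \<longrightarrow> least_squares n x y (fhat x y))"

text \<open>
  The joint law of \<open>(X\<^sub>i, \<epsilon>\<^sub>i)\<close> for \<open>i < n\<close>: all \<open>X\<^sub>i\<close> have law \<open>P\<close>, all \<open>\<epsilon>\<^sub>i\<close> are standard
  normal, and everything is independent. Sample indices start at \<open>0\<close>.
\<close>

definition sample_law :: "nat \<Rightarrow> (real ^ 'd) measure \<Rightarrow> (nat \<Rightarrow> (real ^ 'd) \<times> real) measure" where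
  "sample_law n P = Pi\<^sub>M {..<n} (\<lambda>_. P \<Otimes>\<^sub>M std_normal_distribution)"

text \<open>
  An element of \<open>isotonic_funs\<close> is Lebesgue measurable on the cube but need not be Borel
  measurable. For \<open>P\<close> with a Lebesgue density the loss is therefore only almost everywhere equal
  to a measurable function. The nonnegative integral is invariant under almost everywhere equality,
  with no measurability assumption, and so gives the expectation, whereas the Bochner
  integral of a non-measurable integrand would be \<open>0\<close>.
\<close>

definition risk ::
  "nat \<Rightarrow> (real ^ 'd) measure \<Rightarrow> ((nat \<Rightarrow> real ^ 'd) \<Rightarrow> (nat \<Rightarrow> real) \<Rightarrow> real ^ 'd \<Rightarrow> real)
     \<Rightarrow> (real ^ 'd \<Rightarrow> real) \<Rightarrow> ennreal" where
  "risk n P fhat f\<^sub>0 =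
     (\<integral>\<^sup>+ \<omega>. (let X = (\<lambda>i. fst (\<omega> i)); \<epsilon> = (\<lambda>i. snd (\<omega> i)); Y = (\<lambda>i. f\<^sub>0 (X i) + \<epsilon> i)
            in ennreal ((\<Sum>i<n. (fhat X Y (X i) - f\<^sub>0 (X i))\<^sup>2) / real n))
        \<partial>sample_law n P)"

end

theory Submission
  imports Defs
begin

text \<open>
  Write \<open>d\<close> for the dimension. The bound holds because the least squares loss is
  controlled by the Gaussian process
  \<open>U \<mapsto> S U = (\<Sum>i | X i \<in> U. \<epsilon> i)\<close> indexed by upper sets
  \<open>U\<close> of the cube, and the supremum of this process is of order
  \<open>n powr (1 - 1 / d)\<close> up to logarithms.

  The estimator minimises a sum of squares, so its loss is at most twice the inner product of the
  noise with \<open>fhat - f\<^sub>0\<close> (\<open>least_squares_basic_inequality\<close>).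
  Clipping shows that \<open>fhat\<close> is bounded at the design points by the largest absolute
  response (\<open>least_squares_abs_le\<close>), which is of order \<open>ln n\<close>. A bounded
  isotonic function is an average of indicators of upper sets, its level sets
  (\<open>abs_sum_le_of_level_sets\<close>), so the sum of squared errors is at most a constant
  times \<open>ln n\<close> times the supremum of \<open>\<bar>S U\<bar>\<close>, without any
  localisation around \<open>f\<^sub>0\<close>.

  The supremum is bounded by chaining along dyadic grids (\<open>abs_sum_upper_set_le\<close>).
  Approximate \<open>U\<close> at level \<open>k\<close> from outside by the cells of side
  \<open>2 powr - k\<close> that lie weakly above a cell meeting \<open>U\<close>. Only cells on the
  boundary of \<open>U\<close> cause an error, and there are at most about
  \<open>2 ^ (k * (d - 1))\<close> of them, because each diagonal of the grid meets the boundary at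
  most once (\<open>card_up_boundary\<close>). Such cells contain together, up to a logarithm, at
  most \<open>n / 2 ^ k\<close> design points, and there are at most
  \<open>exp (const * k * 2 ^ (k * (d - 1)))\<close> approximations at level \<open>k\<close>
  (\<open>card_grid_upsets_le\<close>). The increments of \<open>S\<close> from level
  \<open>k\<close> to level \<open>k + 1\<close> are therefore of order at most
  \<open>sqrt (n * k * 2 ^ (k * (d - 2)))\<close>, the square root of their variance times the
  logarithm of their number. The largest such term belongs to the finest level \<open>K\<close>, at
  which a cell has volume about \<open>1 / n\<close>, and it is \<open>n powr (1 - 1 / d)\<close> up
  to logarithms. What remains below level \<open>K\<close> is a sum over at most
  \<open>2 ^ (K * (d - 1)) * ln n\<close> points and is estimated term by term.

  All exceptional events are treated by one device. Each inequality required of the sample has the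
  form \<open>V < 0\<close>, where the expectation of \<open>exp V\<close> is small and factorises
  over the sample. If \<open>Z\<close> is the sum of all these \<open>exp V\<close>, then
  \<open>Z < 1\<close> forces every inequality, while on \<open>Z \<ge> 1\<close> the loss is
  dominated by \<open>n * Z\<close> plus a remainder of expectation \<open>O(1 / n)\<close>. So the
  integral of the loss is at most the good bound plus \<open>n\<close> times the integral of
  \<open>Z\<close> (\<open>risk_le\<close>). The dominating function is measurable although the loss
  need not be. The result is \<open>n powr (- 1 / d) * ln n ^ 3\<close>, and
  \<open>log_exponent d \<ge> 3\<close>.
\<close>

section \<open>Upper sets of a finite grid\<close>

definition grid :: "nat \<Rightarrow> ('d::finite \<Rightarrow> nat) set" where
  "grid m = {c. \<forall>j. c j \<le> m}"

lemma grid_eq_PiE: "grid m = (UNIV :: 'd::finite set) \<rightarrow>\<^sub>E {..m}"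
  by (auto simp: grid_def)

lemma finite_grid [simp]: "finite (grid m)"
  unfolding grid_eq_PiE by (simp add: finite_PiE)

lemma card_grid: "card (grid m :: ('d::finite \<Rightarrow> nat) set) = (m + 1) ^ CARD('d)"
  unfolding grid_eq_PiE by (simp add: card_PiE)

lemma card_grid_face:
  "card {c \<in> grid m. c (j :: 'd::finite) = 0} = (m + 1) ^ (CARD('d) - 1)"
proof -
  let ?F = "\<lambda>i. if i = j then {0} else {..m}"
  have "c \<in> grid m \<and> c j = 0 \<longleftrightarrow> (\<forall>i. c i \<in> ?F i)" for c :: "'d \<Rightarrow> nat"
  proof
    assume H: "\<forall>i. c i \<in> ?F i"
    have "c j = 0"
      using H[rule_format, of j] by simp
    moreover have "c i \<le> m" for i
      using H[rule_format, of i] by (cases "i = j") auto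
    ultimately show "c \<in> grid m \<and> c j = 0"
      by (simp add: grid_def)
  qed (simp add: grid_def)
  then have "{c \<in> grid m. c j = 0} = Pi\<^sub>E UNIV ?F"
    unfolding PiE_UNIV_domain by (intro set_eqI) (simp add: Pi_iff)
  then have "card {c \<in> grid m. c j = 0} = (\<Prod>i\<in>UNIV. card (?F i))"
    by (simp only: card_PiE finite)
  also have "\<dots> = card (?F j) * (\<Prod>i\<in>UNIV - {j}. card (?F i))"
    by (rule prod.remove) simp_all
  also have "(\<Prod>i\<in>UNIV - {j}. card (?F i)) = (\<Prod>i\<in>UNIV - {j}. m + 1)"
    by (rule prod.cong) auto
  finally show ?thesis
    by (simp add: card_Diff_singleton)
qed

definition up_closure :: "nat \<Rightarrow> ('d::finite \<Rightarrow> nat) set \<Rightarrow> ('d \<Rightarrow> nat) set" where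
  "up_closure m V = {c \<in> grid m. \<exists>v\<in>V. \<forall>j. v j \<le> c j}"

definition strict_up_closure :: "nat \<Rightarrow> ('d::finite \<Rightarrow> nat) set \<Rightarrow> ('d \<Rightarrow> nat) set" where
  "strict_up_closure m V = {c \<in> grid m. \<exists>v\<in>V. \<forall>j. v j < c j}"

text \<open>
  The boundary of an upper set is an antichain for the strict coordinatewise order: if \<open>c\<close> and
  \<open>c + t * (1, ..., 1)\<close> with \<open>t > 0\<close> are both above \<open>V\<close>, then the second lies strictly above \<open>V\<close>.
  Hence each diagonal of the grid contains at most one boundary point. Diagonals are indexed by their
  lowest point, which lies on one of the \<open>d\<close> coordinate faces.
\<close>
lemma card_up_boundary:
  fixes V :: "('d::finite \<Rightarrow> nat) set"
  shows "card (up_closure m V - strict_up_closure m V) \<le> CARD('d) * (m + 1) ^ (CARD('d) - 1)"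
proof -
  define B where "B = up_closure m V - strict_up_closure m V"
  \<comment> \<open>The lowest point of the diagonal through \<open>c\<close>.\<close>
  define r :: "('d \<Rightarrow> nat) \<Rightarrow> ('d \<Rightarrow> nat)" where "r c = (\<lambda>j. c j - Min (range c))" for c
  have split: "c j = r c j + Min (range c)" for c j
    by (simp add: r_def)
  have no_two: "\<not> Min (range c) < Min (range c')" if in_B: "c \<in> B" "c' \<in> B" and eq: "r c = r c'" for c c'
  proof
    assume less: "Min (range c) < Min (range c')"
    obtain v where v: "v \<in> V" "\<forall>j. v j \<le> c j"
      using in_B(1) by (auto simp: B_def up_closure_def)
    have "c j < c' j" for j
      unfolding split[of c j] split[of c' j] eq using less by (rule add_strict_left_mono)
    then have "\<forall>j. v j < c' j"
      using v(2) le_less_trans by blast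
    then have "c' \<in> strict_up_closure m V"
      using in_B(2) v(1) by (auto simp: B_def up_closure_def strict_up_closure_def)
    then show False
      using in_B(2) by (simp add: B_def)
  qed
  have "inj_on r B"
  proof (rule inj_onI)
    fix c c' assume *: "c \<in> B" "c' \<in> B" "r c = r c'"
    then have "Min (range c) = Min (range c')"
      using no_two[of c c'] no_two[of c' c] by (metis linorder_neqE_nat)
    then have "c j = c' j" for j
      unfolding split[of c j] split[of c' j] *(3) by simp
    then show "c = c'" by blast
  qed
  moreover have "r ` B \<subseteq> (\<Union>j. {c \<in> grid m. c j = 0})"
  proof
    fix b assume "b \<in> r ` B"
    then obtain c where c: "c \<in> grid m" "b = r c"
      by (auto simp: B_def up_closure_def)
    have "Min (range c) \<in> range c" by (intro Min_in) auto
    then obtain j where "c j = Min (range c)" by (metis imageE)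
    then have "b j = 0" by (simp add: c(2) r_def)
    moreover have "b \<in> grid m"
      using c by (auto simp: grid_def r_def intro: le_trans[OF diff_le_self])
    ultimately show "b \<in> (\<Union>j. {c \<in> grid m. c j = 0})" by auto
  qed
  ultimately have "card B \<le> card (\<Union>j::'d. {c \<in> grid m. c j = 0})"
    by (intro card_inj_on_le[of r]) auto
  also have "\<dots> \<le> (\<Sum>j\<in>(UNIV::'d set). card {c \<in> grid m. c j = 0})"
    by (rule card_UN_le) simp
  finally show ?thesis
    by (simp add: card_grid_face B_def)
qed

definition grid_upsets :: "nat \<Rightarrow> ('d::finite \<Rightarrow> nat) set set" where
  "grid_upsets m = {B. B \<subseteq> grid m \<and> (\<forall>b\<in>B. \<forall>c\<in>grid m. (\<forall>j. b j \<le> c j) \<longrightarrow> c \<in> B)}"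

lemma finite_grid_upsets [simp]: "finite (grid_upsets m)"
  by (rule finite_subset[of _ "Pow (grid m)"]) (auto simp: grid_upsets_def)

lemma up_closure_in_grid_upsets: "up_closure m V \<in> grid_upsets m"
  unfolding grid_upsets_def
proof (intro CollectI conjI ballI impI)
  show "up_closure m V \<subseteq> grid m"
    unfolding up_closure_def by (rule subsetI) (erule CollectE, erule conjunct1)
next
  fix b c assume b: "b \<in> up_closure m V" and c: "c \<in> grid m" "\<forall>j. b j \<le> c j"
  obtain v where v: "v \<in> V" "\<forall>j. v j \<le> b j"
    using b unfolding up_closure_def by blast
  have "v j \<le> c j" for j
    using v(2) c(2) le_trans[of "v j" "b j" "c j"] by simp
  then show "c \<in> up_closure m V"
    unfolding up_closure_def using v(1) c(1) by blast
qed

lemma empty_in_grid_upsets: "{} \<in> grid_upsets m"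
  by (simp add: grid_upsets_def)

text \<open>
  An upper set is determined by its height function: the smallest entry in direction \<open>j\<close> at which
  each column enters the set, with value \<open>m + 1\<close> for a column that never does.
\<close>
lemma card_grid_upsets_le:
  "card (grid_upsets m :: ('d::finite \<Rightarrow> nat) set set) \<le> (m + 2) ^ ((m + 1) ^ (CARD('d) - 1))"
proof -
  obtain j :: 'd where True by simp
  define F where "F = {c \<in> grid m. c j = 0}"
  define S where "S h = {c \<in> grid m. h (c(j := 0)) \<le> c j}" for h :: "('d \<Rightarrow> nat) \<Rightarrow> nat"
  have [simp]: "finite F" by (simp add: F_def)
  have "grid_upsets m \<subseteq> S ` (F \<rightarrow>\<^sub>E {..m+1})"
  proof
    fix B :: "('d \<Rightarrow> nat) set" assume B: "B \<in> grid_upsets m"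
    define h where "h = restrict (\<lambda>c. LEAST s. c(j := s) \<in> B \<or> s = m + 1) F"
    have "h \<in> F \<rightarrow>\<^sub>E {..m+1}"
      by (auto simp: h_def intro: Least_le)
    moreover have "c \<in> B \<longleftrightarrow> h (c(j := 0)) \<le> c j" if c: "c \<in> grid m" for c
    proof -
      have F: "c(j := 0) \<in> F" using c by (auto simp: F_def grid_def)
      let ?Q = "\<lambda>s. c(j := s) \<in> B \<or> s = m + 1"
      have h: "h (c(j := 0)) = (LEAST s. ?Q s)" using F by (simp add: h_def)
      show ?thesis
      proof
        assume "c \<in> B" then show "h (c(j := 0)) \<le> c j"
          unfolding h by (intro Least_le) simp
      next
        assume le: "h (c(j := 0)) \<le> c j"
        have "?Q (h (c(j := 0)))" unfolding h by (rule LeastI[of _ "m + 1"]) simp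
        moreover have "c j \<le> m" using c by (simp add: grid_def)
        ultimately have "c(j := h (c(j := 0))) \<in> B" using le by auto
        moreover have "\<forall>i. (c(j := h (c(j := 0)))) i \<le> c i" using le by simp
        ultimately show "c \<in> B" using B c by (auto simp: grid_upsets_def)
      qed
    qed
    then have "B = S h"
      using B by (auto simp: S_def grid_upsets_def)
    ultimately show "B \<in> S ` (F \<rightarrow>\<^sub>E {..m+1})" by blast
  qed
  then have "card (grid_upsets m :: ('d \<Rightarrow> nat) set set) \<le> card (F \<rightarrow>\<^sub>E {..m+1})"
    by (intro surj_card_le finite_PiE) auto
  also have "\<dots> = (m + 2) ^ ((m + 1) ^ (CARD('d) - 1))"
    by (simp add: card_PiE F_def card_grid_face)
  finally show ?thesis .
qed

lemma card_grid_upsets_le_exp: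
  fixes d :: nat defines "d \<equiv> CARD('d::finite)"
  shows "real (card (grid_upsets (2 ^ k) :: ('d \<Rightarrow> nat) set set))
    \<le> exp ((real k + 2) * 2 ^ ((k + 1) * (d - 1)))"
proof -
  have "card (grid_upsets (2 ^ k) :: ('d \<Rightarrow> nat) set set) \<le> (2 ^ k + 2) ^ ((2 ^ k + 1) ^ (d - 1))"
    unfolding d_def by (rule card_grid_upsets_le)
  also have "\<dots> \<le> (2 ^ (k + 2)) ^ ((2 ^ k + 1) ^ (d - 1))"
  proof (rule power_mono)
    have "(2::nat) ^ (k + 2) = 4 * 2 ^ k" by simp
    moreover have "(1::nat) \<le> 2 ^ k" by simp
    ultimately show "2 ^ k + 2 \<le> (2 ^ (k + 2) :: nat)" by linarith
  qed simp
  also have "\<dots> \<le> (2 ^ (k + 2)) ^ ((2 ^ (k + 1)) ^ (d - 1))"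
    by (intro power_increasing power_mono) simp_all
  also have "\<dots> = 2 ^ ((k + 2) * 2 ^ ((k + 1) * (d - 1)))"
    by (simp only: power_mult)
  finally have "real (card (grid_upsets (2 ^ k) :: ('d \<Rightarrow> nat) set set))
      \<le> real (2 ^ ((k + 2) * 2 ^ ((k + 1) * (d - 1))))"
    by (rule of_nat_mono)
  also have "\<dots> = 2 ^ ((k + 2) * 2 ^ ((k + 1) * (d - 1)))"
    by simp
  also have "\<dots> \<le> exp 1 ^ ((k + 2) * 2 ^ ((k + 1) * (d - 1)))"
    using exp_ge_add_one_self[of 1] by (intro power_mono) auto
  also have "\<dots> = exp ((real k + 2) * 2 ^ ((k + 1) * (d - 1)))"
    by (simp add: algebra_simps flip: exp_of_nat_mult)
  finally show ?thesis .
qed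

text \<open>
  The entropy of the links between levels \<open>k\<close> and \<open>k + 1\<close>. The dependence on \<open>k\<close> is kept only in the
  factor \<open>2 ^ (k * (d - 1))\<close>, the order of the boundary; the logarithmic factor is bounded by its value
  at the finest level.
\<close>
lemma card_increment_regions_le_exp:
  fixes d :: nat defines "d \<equiv> CARD('d::finite)"
  assumes "k \<le> K"
  shows "real (card (grid_upsets (2 ^ k) :: ('d \<Rightarrow> nat) set set))
      * real (card (grid_upsets (2 ^ (k + 1)) :: ('d \<Rightarrow> nat) set set))
    \<le> exp (2 * 4 ^ d * (real K + 3) * 2 ^ (k * (d - 1)))"
proof -
  have "(k + 1) * (d - 1) \<le> (k + 2) * (d - 1)" by simp
  then have 1: "(real k + 2) * 2 ^ ((k + 1) * (d - 1)) \<le> (real K + 3) * 2 ^ ((k + 2) * (d - 1))"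
    using \<open>k \<le> K\<close> by (intro mult_mono power_increasing) auto
  have 2: "(real k + 3) * 2 ^ ((k + 2) * (d - 1)) \<le> (real K + 3) * 2 ^ ((k + 2) * (d - 1))"
    using \<open>k \<le> K\<close> by (intro mult_right_mono) auto
  have "(2::real) ^ ((k + 2) * (d - 1)) = 4 ^ (d - 1) * 2 ^ (k * (d - 1))"
    by (simp add: add_mult_distrib power_add flip: power_mult_distrib)
  also have "\<dots> \<le> 4 ^ d * 2 ^ (k * (d - 1))"
    by (intro mult_right_mono power_increasing) auto
  finally have 3: "(real K + 3) * 2 ^ ((k + 2) * (d - 1)) \<le> (real K + 3) * (4 ^ d * 2 ^ (k * (d - 1)))"
    by (intro mult_left_mono) auto
  have "real (card (grid_upsets (2 ^ k) :: ('d \<Rightarrow> nat) set set))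
      * real (card (grid_upsets (2 ^ (k + 1)) :: ('d \<Rightarrow> nat) set set))
    \<le> exp ((real k + 2) * 2 ^ ((k + 1) * (d - 1))) * exp ((real k + 3) * 2 ^ ((k + 2) * (d - 1)))"
    using card_grid_upsets_le_exp[where 'd = 'd, of k] card_grid_upsets_le_exp[where 'd = 'd, of "k + 1"]
    unfolding d_def by (intro mult_mono) (auto simp: algebra_simps)
  also have "\<dots> \<le> exp (2 * 4 ^ d * (real K + 3) * 2 ^ (k * (d - 1)))"
  proof -
    have "2 * 4 ^ d * (real K + 3) * 2 ^ (k * (d - 1)) = 2 * ((real K + 3) * (4 ^ d * 2 ^ (k * (d - 1))))"
      by simp
    then show ?thesis
      unfolding exp_add[symmetric] exp_le_cancel_iff using 1 2 3 by linarith
  qed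
  finally show ?thesis .
qed


section \<open>Dyadic cells of the cube\<close>

text \<open>
  The index of the half-open dyadic cell of side \<open>2 powr - k\<close> containing \<open>x\<close>. A coordinate equal to \<open>1\<close>
  gives the extra index \<open>2 ^ k\<close>, which is why the grid of level \<open>k\<close> is \<open>grid (2 ^ k)\<close>.
\<close>
definition cell :: "nat \<Rightarrow> real ^ 'd \<Rightarrow> 'd::finite \<Rightarrow> nat" where
  "cell k x j = nat \<lfloor>2 ^ k * x $ j\<rfloor>"

lemma cube_iff: "x \<in> {0..1::real ^ 'd} \<longleftrightarrow> (\<forall>j. 0 \<le> x $ j \<and> x $ j \<le> 1)"
  by (auto simp: less_eq_vec_def)

lemma cell_in_grid: "x \<in> {0..1} \<Longrightarrow> cell k x \<in> grid (2 ^ k)"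
proof -
  assume x: "x \<in> {0..1}"
  have "\<lfloor>2 ^ k * x $ j\<rfloor> \<le> 2 ^ k" for j
  proof -
    have "2 ^ k * x $ j \<le> 2 ^ k * 1" using x by (intro mult_left_mono) (auto simp: less_eq_vec_def)
    also have "\<dots> < 2 ^ k + 1" by simp
    finally show ?thesis by (simp add: floor_le_iff)
  qed
  then show ?thesis by (simp add: cell_def grid_def nat_le_iff)
qed

lemma cell_coarsen:
  assumes "k \<le> K" shows "cell k x j = cell K x j div 2 ^ (K - k)"
proof -
  have "(2::real) ^ k * x $ j = 2 ^ K * x $ j / real_of_int (2 ^ (K - k))"
    using assms by (simp add: field_simps flip: power_add)
  then have "\<lfloor>2 ^ k * x $ j\<rfloor> = \<lfloor>2 ^ K * x $ j\<rfloor> div 2 ^ (K - k)"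
    using floor_divide_real_eq_div[of "2 ^ (K - k)" "2 ^ K * x $ j"] by simp
  then show ?thesis
    by (simp add: cell_def nat_div_distrib' nat_power_eq)
qed

text \<open>
  Weak comparison of cells says nothing about points in them, strict comparison does. This is why
  the approximation error of an upper set is confined to the cells above it but not strictly above.
\<close>
lemma cell_strictly_below:
  assumes "\<forall>j. cell k x j < cell k y j"
  shows "x \<le> y"
  unfolding less_eq_vec_def
proof
  fix j
  have "\<lfloor>2 ^ k * x $ j\<rfloor> < \<lfloor>2 ^ k * y $ j\<rfloor>"
    using assms by (simp add: cell_def zless_nat_conj)
  then have "2 ^ k * x $ j < 2 ^ k * y $ j"
    by (meson floor_mono not_le)
  then show "x $ j \<le> y $ j" by simp
qed

text \<open>
  A bound on the occupancy at the finest level \<open>K\<close> controls all coarser levels, because a cell of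
  level \<open>k\<close> is the union of \<open>2 ^ ((K - k) * d)\<close> cells of level \<open>K\<close>.
\<close>
lemma card_points_in_cells_le:
  fixes x :: "nat \<Rightarrow> real ^ 'd::finite"
  assumes cube: "\<And>i. i < n \<Longrightarrow> x i \<in> {0..1}" and "k \<le> K" "finite E" "0 \<le> L"
    and cells: "\<And>c. c \<in> grid (2 ^ K) \<Longrightarrow> real (card {i. i < n \<and> cell K (x i) = c}) \<le> L"
  shows "real (card {i. i < n \<and> cell k (x i) \<in> E}) \<le> real (card E) * 2 ^ ((K - k) * CARD('d)) * L"
proof -
  define q where "q = (2::nat) ^ (K - k)"
  define Ch where "Ch c = Pi\<^sub>E (UNIV :: 'd set) (\<lambda>j. {c j * q..<(c j + 1) * q})" for c
  have [simp]: "finite (Ch c)" for c by (simp add: Ch_def finite_PiE)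
  have cells': "real (card {i. i < n \<and> cell K (x i) = c}) \<le> L" for c
  proof (cases "c \<in> grid (2 ^ K)")
    case False
    then have "{i. i < n \<and> cell K (x i) = c} = {}"
      using cube cell_in_grid[of _ K] by blast
    then show ?thesis using \<open>0 \<le> L\<close> by (simp only: card.empty of_nat_0)
  qed (rule cells)
  have "card (Ch c) = q ^ CARD('d)" for c
    by (simp add: Ch_def card_PiE)
  then have card_desc: "card (\<Union>c\<in>E. Ch c) \<le> card E * q ^ CARD('d)"
    using card_UN_le[of E Ch] \<open>finite E\<close> by simp
  have "{i. i < n \<and> cell k (x i) \<in> E} \<subseteq> (\<Union>c\<in>(\<Union>c\<in>E. Ch c). {i. i < n \<and> cell K (x i) = c})"
  proof
    fix i assume i: "i \<in> {i. i < n \<and> cell k (x i) \<in> E}"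
    have "cell K (x i) j \<in> {cell k (x i) j * q..<(cell k (x i) j + 1) * q}" for j
    proof -
      have "cell k (x i) j * q + cell K (x i) j mod q = cell K (x i) j"
        unfolding cell_coarsen[OF \<open>k \<le> K\<close>, of "x i" j] q_def by (rule div_mult_mod_eq)
      moreover have "cell K (x i) j mod q < q" by (simp add: q_def)
      ultimately show ?thesis by (simp add: algebra_simps)
    qed
    then have "cell K (x i) \<in> Ch (cell k (x i))"
      by (simp add: Ch_def PiE_UNIV_domain Pi_iff)
    then show "i \<in> (\<Union>c\<in>(\<Union>c\<in>E. Ch c). {i. i < n \<and> cell K (x i) = c})"
      using i by blast
  qed
  then have "card {i. i < n \<and> cell k (x i) \<in> E}
      \<le> card (\<Union>c\<in>(\<Union>c\<in>E. Ch c). {i. i < n \<and> cell K (x i) = c})"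
    using \<open>finite E\<close> by (intro card_mono) auto
  also have "\<dots> \<le> (\<Sum>c\<in>(\<Union>c\<in>E. Ch c). card {i. i < n \<and> cell K (x i) = c})"
    using \<open>finite E\<close> by (intro card_UN_le) auto
  finally have "real (card {i. i < n \<and> cell k (x i) \<in> E})
      \<le> (\<Sum>c\<in>(\<Union>c\<in>E. Ch c). real (card {i. i < n \<and> cell K (x i) = c}))"
    by (simp flip: of_nat_sum)
  also have "\<dots> \<le> real (card (\<Union>c\<in>E. Ch c)) * L"
    using cells' by (intro sum_bounded_above)
  also have "\<dots> \<le> real (card E * q ^ CARD('d)) * L"
    using card_desc \<open>0 \<le> L\<close> by (intro mult_right_mono) (simp_all only: of_nat_le_iff)
  finally show ?thesis
    by (simp add: q_def power_mult)
qed


section \<open>Chaining over upper sets\<close>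

text \<open>
  The deterministic part of the chaining argument. Here \<open>L\<close> bounds the occupancy of the finest cells
  and the size of the noise, and the hypothesis on increments is what an exponential inequality with
  parameter \<open>1 / sqrt 2 ^ ((K - k) * d)\<close> gives for the sum of the noise over a link: half the
  parameter times the number of points, plus the entropy \<open>a * 2 ^ (k * (d - 1))\<close> over the parameter.
  This parameter makes the two terms comparable at every level.
\<close>
lemma abs_sum_upper_set_le:
  fixes x :: "nat \<Rightarrow> real ^ 'd::finite" and e :: "nat \<Rightarrow> real"
  defines "d \<equiv> CARD('d)"
  assumes "d \<ge> 2"
    and cube: "\<And>i. i < n \<Longrightarrow> x i \<in> {0..1}"
    and I: "I \<subseteq> {..<n}" and up: "\<And>i i'. i \<in> I \<Longrightarrow> i' < n \<Longrightarrow> x i \<le> x i' \<Longrightarrow> i' \<in> I"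
    and n: "real n \<le> 2 ^ d * 2 ^ (K * d)" and "1 \<le> L" "0 \<le> a"
    and cells: "\<And>c. c \<in> grid (2 ^ K) \<Longrightarrow> real (card {i. i < n \<and> cell K (x i) = c}) \<le> L"
    and noise: "\<And>i. i < n \<Longrightarrow> \<bar>e i\<bar> \<le> L"
    and incr: "\<And>k B B'. k \<le> K \<Longrightarrow> B \<in> grid_upsets (2 ^ k) \<Longrightarrow> B' \<in> grid_upsets (2 ^ (k + 1)) \<Longrightarrow>
      \<bar>\<Sum>i\<in>{i. i < n \<and> cell k (x i) \<in> B \<and> cell (k + 1) (x i) \<notin> B'}. e i\<bar>
        \<le> real (card {i. i < n \<and> cell k (x i) \<in> B \<and> cell (k + 1) (x i) \<notin> B'})
            / (2 * sqrt 2 ^ ((K - k) * d)) + a * 2 ^ (k * (d - 1)) * sqrt 2 ^ ((K - k) * d)"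
  shows "\<bar>\<Sum>i\<in>I. e i\<bar>
    \<le> 2 ^ (K * (d - 1)) * ((real K + 1) * (real d * 2 ^ d * L + a) + real d * 2 ^ d * L\<^sup>2)"
proof -
  define V where "V k = cell k ` x ` I" for k
  define B where "B k = up_closure (2 ^ k) (V k)" for k
  define J where "J k = {i. i < n \<and> cell k (x i) \<in> B k}" for k
  \<comment> \<open>\<open>J k\<close> consists of the points in the outer approximation at level \<open>k\<close>; it decreases in \<open>k\<close>.
      \<open>T\<close> bounds every link of the chain, the critical level being the finest.\<close>
  define T where "T = 2 ^ (K * (d - 1)) * (real d * 2 ^ d * L + a)"
  have fin: "finite (J k)" for k by (simp add: J_def)
  have B_upset: "B k \<in> grid_upsets (2 ^ k)" for k
    unfolding B_def by (rule up_closure_in_grid_upsets)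
  have I_J: "I \<subseteq> J k" for k
  proof
    fix i assume i: "i \<in> I"
    then have "i < n" using I by auto
    then have "cell k (x i) \<in> grid (2 ^ k)" using cube cell_in_grid by blast
    then have "cell k (x i) \<in> B k" using i by (auto simp: B_def up_closure_def V_def)
    then show "i \<in> J k" using \<open>i < n\<close> by (simp add: J_def)
  qed
  have J_Suc: "J (k + 1) \<subseteq> J k" for k
  proof
    fix i assume i: "i \<in> J (k + 1)"
    then have "i < n" by (simp add: J_def)
    obtain u where u: "u \<in> I" "\<forall>j. cell (k + 1) (x u) j \<le> cell (k + 1) (x i) j"
      using i by (auto simp: J_def B_def V_def up_closure_def)
    have "cell k (x u) j \<le> cell k (x i) j" for j
      using u(2) by (simp add: cell_coarsen[of k "k + 1"] div_le_mono)
    moreover have "cell k (x i) \<in> grid (2 ^ k)" using \<open>i < n\<close> cube cell_in_grid by blast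
    ultimately show "i \<in> J k"
      using u(1) \<open>i < n\<close> by (auto simp: J_def B_def V_def up_closure_def)
  qed
  have card_J: "real (card (J k - I)) \<le> real d * 2 ^ d * 2 ^ (k * (d - 1)) * 2 ^ ((K - k) * d) * L"
    if "k \<le> K" for k
  proof -
    define E where "E = B k - strict_up_closure (2 ^ k) (V k)"
    have "finite E" by (rule finite_subset[of _ "grid (2 ^ k)"]) (auto simp: E_def B_def up_closure_def)
    have "J k - I \<subseteq> {i. i < n \<and> cell k (x i) \<in> E}"
    proof
      fix i assume i: "i \<in> J k - I"
      have "cell k (x i) \<notin> strict_up_closure (2 ^ k) (V k)"
      proof
        assume "cell k (x i) \<in> strict_up_closure (2 ^ k) (V k)"
        then obtain u where u: "u \<in> I" "\<forall>j. cell k (x u) j < cell k (x i) j"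
          by (auto simp: strict_up_closure_def V_def)
        have "x u \<le> x i" using u(2) by (rule cell_strictly_below)
        then show False using up u(1) i by (auto simp: J_def)
      qed
      then show "i \<in> {i. i < n \<and> cell k (x i) \<in> E}"
        using i by (simp add: J_def E_def)
    qed
    then have "real (card (J k - I)) \<le> real (card {i. i < n \<and> cell k (x i) \<in> E})"
      by (intro of_nat_mono card_mono) auto
    also have "\<dots> \<le> real (card E) * 2 ^ ((K - k) * d) * L"
      unfolding d_def using cube that \<open>finite E\<close> \<open>1 \<le> L\<close> cells by (intro card_points_in_cells_le) auto
    also have "real (card E) \<le> real d * 2 ^ d * 2 ^ (k * (d - 1))"
    proof -
      have "card E \<le> d * (2 ^ k + 1) ^ (d - 1)"
        unfolding E_def B_def d_def by (rule card_up_boundary)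
      also have "(2 ^ k + 1 :: nat) ^ (d - 1) \<le> (2 ^ (k + 1)) ^ (d - 1)"
        by (intro power_mono) simp_all
      also have "\<dots> = 2 ^ (d - 1) * 2 ^ (k * (d - 1))"
        by (simp add: algebra_simps flip: power_mult power_add)
      also have "\<dots> \<le> 2 ^ d * 2 ^ (k * (d - 1))"
        by (intro mult_right_mono power_increasing) simp_all
      finally have "card E \<le> d * (2 ^ d * 2 ^ (k * (d - 1)))" by simp
      then have "real (card E) \<le> real (d * (2 ^ d * 2 ^ (k * (d - 1))))"
        by (rule of_nat_mono)
      then show ?thesis by (simp add: mult.assoc)
    qed
    finally show ?thesis using \<open>1 \<le> L\<close> by (simp add: mult_right_mono)
  qed
  have level: "N / (2 * sqrt 2 ^ ((K - k) * d)) + a * 2 ^ (k * (d - 1)) * sqrt 2 ^ ((K - k) * d) \<le> T"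
    if k: "k \<le> K" and N: "N \<le> real d * 2 ^ d * 2 ^ (k * (d - 1)) * 2 ^ ((K - k) * d) * L" for N k
  proof -
    define q where "q = (K - k) * d"
    have sq: "(2::real) ^ q = sqrt 2 ^ q * sqrt 2 ^ q"
      by (simp flip: power_mult_distrib)
    \<comment> \<open>Both terms are of order \<open>sqrt 2 ^ (q + 2 * k * (d - 1))\<close>. As \<open>d \<le> 2 * (d - 1)\<close>, this exponent is
        largest at \<open>k = K\<close>; here the dimension has to be at least two.\<close>
    have "q + 2 * (k * (d - 1)) \<le> 2 * (K * (d - 1))"
    proof -
      have "d \<le> 2 * (d - 1)" using \<open>d \<ge> 2\<close> by simp
      then have "q \<le> (K - k) * (2 * (d - 1))" unfolding q_def by (rule mult_le_mono2)
      also have "\<dots> = 2 * (K * (d - 1)) - 2 * (k * (d - 1))"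
        by (simp add: diff_mult_distrib)
      finally show ?thesis using mult_le_mono1[OF k, of "d - 1"] by linarith
    qed
    then have "sqrt 2 ^ (q + 2 * (k * (d - 1))) \<le> sqrt 2 ^ (2 * (K * (d - 1)))"
      by (intro power_increasing) auto
    then have expo: "2 ^ (k * (d - 1)) * sqrt 2 ^ q \<le> 2 ^ (K * (d - 1))"
      by (simp add: power_add power_mult mult.commute)
    have "N / (2 * sqrt 2 ^ q) \<le> (real d * 2 ^ d * 2 ^ (k * (d - 1)) * 2 ^ q * L) / (2 * sqrt 2 ^ q)"
      using N unfolding q_def by (intro divide_right_mono) auto
    also have "\<dots> = (real d * 2 ^ d * L) / 2 * (2 ^ (k * (d - 1)) * sqrt 2 ^ q)"
      unfolding sq by (simp add: field_simps)
    also have "\<dots> \<le> (real d * 2 ^ d * L) * (2 ^ (k * (d - 1)) * sqrt 2 ^ q)"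
      using \<open>1 \<le> L\<close> by (intro mult_right_mono) auto
    finally have "N / (2 * sqrt 2 ^ q) + a * 2 ^ (k * (d - 1)) * sqrt 2 ^ q
        \<le> (real d * 2 ^ d * L + a) * (2 ^ (k * (d - 1)) * sqrt 2 ^ q)"
      by (simp add: algebra_simps)
    also have "\<dots> \<le> T"
      unfolding T_def using expo \<open>1 \<le> L\<close> \<open>0 \<le> a\<close>
      by (subst mult.commute) (intro mult_right_mono, auto)
    finally show ?thesis by (simp add: q_def)
  qed
  have D: "\<bar>\<Sum>i\<in>J k - J (k + 1). e i\<bar> \<le> T" if "k \<le> K" for k
  proof -
    have eq: "J k - J (k + 1) = {i. i < n \<and> cell k (x i) \<in> B k \<and> cell (k + 1) (x i) \<notin> B (k + 1)}"
      by (auto simp: J_def)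
    have "card (J k - J (k + 1)) \<le> card (J k - I)"
      using I_J[of "k + 1"] fin by (intro card_mono) auto
    then have "real (card (J k - J (k + 1))) \<le> real d * 2 ^ d * 2 ^ (k * (d - 1)) * 2 ^ ((K - k) * d) * L"
      using card_J[OF that] by linarith
    then show ?thesis
      using incr[OF that B_upset[of k] B_upset[of "k + 1"]] level[OF that] unfolding eq
      by (blast intro: order_trans)
  qed
  \<comment> \<open>The start of the chain is itself a link, towards the empty upper set of level one. It has at most
      \<open>n\<close> points, and \<open>n\<close> is comparable to the number of cells at the finest level.\<close>
  have J0: "\<bar>\<Sum>i\<in>J 0. e i\<bar> \<le> T"
  proof -
    have eq: "J 0 = {i. i < n \<and> cell 0 (x i) \<in> B 0 \<and> cell (0 + 1) (x i) \<notin> {}}"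
      by (simp add: J_def)
    have "card (J 0) \<le> card {..<n}"
      by (intro card_mono) (auto simp: J_def)
    then have "real (card (J 0)) \<le> 2 ^ d * 2 ^ (K * d)"
      using n by simp
    also have "\<dots> \<le> (real d * L) * (2 ^ d * 2 ^ (K * d))"
    proof -
      have "1 * 1 \<le> real d * L" using \<open>d \<ge> 2\<close> \<open>1 \<le> L\<close> by (intro mult_mono) auto
      then show ?thesis using mult_right_mono[of 1 "real d * L" "2 ^ d * 2 ^ (K * d)"] by simp
    qed
    finally have "real (card (J 0)) \<le> real d * 2 ^ d * 2 ^ (0 * (d - 1)) * 2 ^ ((K - 0) * d) * L"
      by (simp add: algebra_simps)
    then show ?thesis
      using incr[OF le0 B_upset[of 0] empty_in_grid_upsets] level[OF le0] unfolding eq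
      by (blast intro: order_trans)
  qed
  have J: "\<bar>\<Sum>i\<in>J m. e i\<bar> \<le> (real m + 1) * T" if "m \<le> K" for m
    using that
  proof (induction m)
    case (Suc m)
    have "(\<Sum>i\<in>J m. e i) = (\<Sum>i\<in>J m - J (m + 1). e i) + (\<Sum>i\<in>J (m + 1). e i)"
      using J_Suc fin by (rule sum.subset_diff)
    then have "\<bar>\<Sum>i\<in>J (m + 1). e i\<bar> \<le> \<bar>\<Sum>i\<in>J m. e i\<bar> + \<bar>\<Sum>i\<in>J m - J (m + 1). e i\<bar>"
      by linarith
    also have "\<dots> \<le> (real m + 1) * T + T"
      using Suc D[of m] by (intro add_mono) auto
    finally show ?case by (simp add: algebra_simps)
  qed (use J0 in simp)
  have "(\<Sum>i\<in>J K. e i) = (\<Sum>i\<in>J K - I. e i) + (\<Sum>i\<in>I. e i)"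
    using I_J fin by (rule sum.subset_diff)
  then have "\<bar>\<Sum>i\<in>I. e i\<bar> \<le> \<bar>\<Sum>i\<in>J K. e i\<bar> + \<bar>\<Sum>i\<in>J K - I. e i\<bar>"
    by linarith
  also have "\<bar>\<Sum>i\<in>J K - I. e i\<bar> \<le> (\<Sum>i\<in>J K - I. \<bar>e i\<bar>)"
    by (rule sum_abs)
  also have "\<dots> \<le> real (card (J K - I)) * L"
    using noise by (intro sum_bounded_above) (auto simp: J_def)
  also have "\<dots> \<le> (real d * 2 ^ d * 2 ^ (K * (d - 1)) * L) * L"
    using card_J[of K] \<open>1 \<le> L\<close> by (intro mult_right_mono) auto
  finally have "\<bar>\<Sum>i\<in>I. e i\<bar> \<le> (real K + 1) * T + (real d * 2 ^ d * 2 ^ (K * (d - 1)) * L) * L"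
    using J[of K] by linarith
  then show ?thesis
    by (simp add: T_def algebra_simps power2_eq_square)
qed


section \<open>Isotonic least squares\<close>

text \<open>
  The layer cake formula: \<open>v i\<close> is the integral over \<open>t \<in> {0..b}\<close> of the indicator of \<open>t \<le> v i\<close>, so the
  weighted sum is an integral of level set sums over an interval of length \<open>b\<close>.
\<close>
lemma abs_sum_le_of_level_sets:
  fixes w v :: "'a \<Rightarrow> real"
  assumes "finite I" "0 \<le> b" and v: "\<And>i. i \<in> I \<Longrightarrow> 0 \<le> v i \<and> v i \<le> b"
    and S: "\<And>t. \<bar>\<Sum>i\<in>{i \<in> I. t \<le> v i}. w i\<bar> \<le> S"
  shows "\<bar>\<Sum>i\<in>I. w i * v i\<bar> \<le> b * S"
proof -
  have "((\<lambda>t. if t \<in> {0..v i} then 1 else 0) has_integral v i) {0..b}" if "i \<in> I" for i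
    using has_integral_const_real[of "1::real" 0 "v i"] v[OF that]
    by (subst has_integral_restrict) auto
  then have int: "((\<lambda>t. \<Sum>i\<in>I. w i * (if t \<in> {0..v i} then 1 else 0))
      has_integral (\<Sum>i\<in>I. w i * v i)) {0..b}"
    using \<open>finite I\<close> by (intro has_integral_sum has_integral_mult_right) auto
  have "norm (\<Sum>i\<in>I. w i * (if t \<in> {0..v i} then 1 else 0)) \<le> S" if "t \<in> {0..b}" for t
  proof -
    have "(\<Sum>i\<in>I. w i * (if t \<in> {0..v i} then 1 else 0)) = (\<Sum>i\<in>I. if t \<le> v i then w i else 0)"
      using that by (intro sum.cong) auto
    also have "\<dots> = (\<Sum>i\<in>{i \<in> I. t \<le> v i}. w i)"
      using \<open>finite I\<close> by (simp add: sum.inter_filter)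
    finally show ?thesis using S[of t] by simp
  qed
  moreover have "0 \<le> S" using S[of 0] by linarith
  ultimately have "norm (\<Sum>i\<in>I. w i * v i) \<le> S * measure lborel {0..b}"
    using int by (intro has_integral_bound_real[OF _ finite.emptyI int]) auto
  then show ?thesis
    using \<open>0 \<le> b\<close> by (simp add: mult.commute)
qed

lemma least_squares_isotonic: "least_squares n x y g \<Longrightarrow> g \<in> isotonic_funs"
  by (simp add: least_squares_def is_arg_min_def)

lemma least_squares_min:
  "least_squares n x y g \<Longrightarrow> h \<in> isotonic_funs \<Longrightarrow>
    (\<Sum>i<n. (y i - g (x i))\<^sup>2) \<le> (\<Sum>i<n. (y i - h (x i))\<^sup>2)"
  by (auto simp: least_squares_def is_arg_min_def not_less)

text \<open>Comparing the minimiser with the truth and cancelling the squared noise.\<close>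
lemma least_squares_basic_inequality:
  assumes "least_squares n x y g" "f \<in> isotonic_funs" and y: "\<And>i. i < n \<Longrightarrow> y i = f (x i) + e i"
  shows "(\<Sum>i<n. (g (x i) - f (x i))\<^sup>2) \<le> 2 * (\<Sum>i<n. e i * (g (x i) - f (x i)))"
proof -
  have "(\<Sum>i<n. (y i - g (x i))\<^sup>2)
      = (\<Sum>i<n. (y i - f (x i))\<^sup>2 - 2 * (e i * (g (x i) - f (x i))) + (g (x i) - f (x i))\<^sup>2)"
    by (rule sum.cong) (auto simp: y power2_eq_square algebra_simps)
  then show ?thesis
    using least_squares_min[OF assms(1,2)]
    by (simp add: sum.distrib sum_subtractf flip: sum_distrib_left)
qed

lemma least_squares_loss_le_noise:
  assumes "least_squares n x y g" "f \<in> isotonic_funs" "\<And>i. i < n \<Longrightarrow> y i = f (x i) + e i"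
  shows "(\<Sum>i<n. (g (x i) - f (x i))\<^sup>2) \<le> 4 * (\<Sum>i<n. (e i)\<^sup>2)"
proof -
  have "2 * (e i * u) \<le> 2 * (e i)\<^sup>2 + u\<^sup>2 / 2" for i u
    using zero_le_power2[of "2 * e i - u"] by (simp add: power2_eq_square algebra_simps)
  then have "(\<Sum>i<n. 2 * (e i * (g (x i) - f (x i))))
      \<le> (\<Sum>i<n. 2 * (e i)\<^sup>2 + (g (x i) - f (x i))\<^sup>2 / 2)"
    by (intro sum_mono)
  then show ?thesis
    using least_squares_basic_inequality[OF assms]
    by (simp add: sum.distrib flip: sum_distrib_left sum_divide_distrib)
qed

text \<open>
  Clipping \<open>g\<close> to \<open>{- b..b}\<close> keeps it isotonic, moves no value away from the responses and strictly
  improves the fit at a design point where \<open>g\<close> leaves the interval.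
\<close>
lemma least_squares_abs_le:
  assumes ls: "least_squares n x y g" and y: "\<And>i. i < n \<Longrightarrow> \<bar>y i\<bar> \<le> b" and "j < n"
  shows "\<bar>g (x j)\<bar> \<le> b"
proof (rule ccontr)
  assume large: "\<not> \<bar>g (x j)\<bar> \<le> b"
  define h where "h z = max (- b) (min b (g z))" for z
  have "h \<in> isotonic_funs"
    using least_squares_isotonic[OF ls] unfolding isotonic_funs_def h_def
    by (intro CollectI mono_onI max.mono min.mono order_refl) (auto dest: mono_onD)
  moreover have "(\<Sum>i<n. (y i - h (x i))\<^sup>2) < (\<Sum>i<n. (y i - g (x i))\<^sup>2)"
  proof (rule sum_strict_mono_ex1)
    have "\<bar>v - max (- b) (min b u)\<bar> \<le> \<bar>v - u\<bar>" if "\<bar>v\<bar> \<le> b" for u v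
      using that by arith
    then show "\<forall>i\<in>{..<n}. (y i - h (x i))\<^sup>2 \<le> (y i - g (x i))\<^sup>2"
      using y by (simp add: h_def flip: abs_le_square_iff)
    have "\<bar>y j - h (x j)\<bar> < \<bar>y j - g (x j)\<bar>"
      using y[OF \<open>j < n\<close>] large unfolding h_def by arith
    then have "\<not> (y j - g (x j))\<^sup>2 \<le> (y j - h (x j))\<^sup>2"
      unfolding abs_le_square_iff[symmetric] by simp
    then show "\<exists>i\<in>{..<n}. (y i - h (x i))\<^sup>2 < (y i - g (x i))\<^sup>2"
      using \<open>j < n\<close> by (intro bexI[of _ j]) (auto simp: not_le)
  qed simp
  ultimately show False
    using least_squares_min[OF ls, of h] by simp
qed

text \<open>
  Adding the constant \<open>1 + L\<close> makes the estimator and the truth nonnegative at the design points without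
  changing their difference; the level sets of both are upper sets of design points, so each of
  them contributes at most \<open>2 * (1 + L) * S\<close> to the inner product with the noise.
\<close>
lemma least_squares_loss_le_upper_sums:
  fixes x :: "nat \<Rightarrow> real ^ 'd::finite"
  assumes ls: "least_squares n x y g" and f: "f \<in> isotonic_funs \<inter> sup_ball 1"
    and y: "\<And>i. i < n \<Longrightarrow> y i = f (x i) + e i"
    and cube: "\<And>i. i < n \<Longrightarrow> x i \<in> {0..1}"
    and noise: "\<And>i. i < n \<Longrightarrow> \<bar>e i\<bar> \<le> L"
    and S: "\<And>I. I \<subseteq> {..<n} \<Longrightarrow> (\<And>i i'. i \<in> I \<Longrightarrow> i' < n \<Longrightarrow> x i \<le> x i' \<Longrightarrow> i' \<in> I) \<Longrightarrow> \<bar>\<Sum>i\<in>I. e i\<bar> \<le> S"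
    and "0 \<le> L"
  shows "(\<Sum>i<n. (g (x i) - f (x i))\<^sup>2) \<le> 8 * (1 + L) * S"
proof -
  have f_abs: "\<bar>f (x i)\<bar> \<le> 1" if "i < n" for i
    using f cube[OF that] by (simp add: sup_ball_def)
  have "\<bar>y i\<bar> \<le> 1 + L" if "i < n" for i
    using f_abs[OF that] noise[OF that] y[OF that] by linarith
  then have g_abs: "\<bar>g (x i)\<bar> \<le> 1 + L" if "i < n" for i
    using least_squares_abs_le[OF ls] that by blast
  have bound: "\<bar>\<Sum>i<n. e i * (h (x i) + (1 + L))\<bar> \<le> 2 * (1 + L) * S"
    if h: "h \<in> isotonic_funs" and h_abs: "\<And>i. i < n \<Longrightarrow> \<bar>h (x i)\<bar> \<le> 1 + L" for h
  proof (rule abs_sum_le_of_level_sets)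
    show "0 \<le> h (x i) + (1 + L) \<and> h (x i) + (1 + L) \<le> 2 * (1 + L)" if "i \<in> {..<n}" for i
      using h_abs[of i] that unfolding abs_le_iff by simp
    show "\<bar>\<Sum>i\<in>{i \<in> {..<n}. t \<le> h (x i) + (1 + L)}. e i\<bar> \<le> S" for t
    proof (rule S)
      fix i i' assume i: "i \<in> {i \<in> {..<n}. t \<le> h (x i) + (1 + L)}" "i' < n" "x i \<le> x i'"
      then have "h (x i) \<le> h (x i')"
        using h cube[of i] cube[of i'] by (intro mono_onD[of "{0..1}" h]) (auto simp: isotonic_funs_def)
      then show "i' \<in> {i \<in> {..<n}. t \<le> h (x i) + (1 + L)}"
        using i by simp
    qed auto
  qed (use \<open>0 \<le> L\<close> in auto)
  have "(\<Sum>i<n. (g (x i) - f (x i))\<^sup>2) \<le> 2 * (\<Sum>i<n. e i * (g (x i) - f (x i)))"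
    using f by (intro least_squares_basic_inequality[OF ls _ y]) auto
  also have "(\<Sum>i<n. e i * (g (x i) - f (x i)))
      = (\<Sum>i<n. e i * (g (x i) + (1 + L))) - (\<Sum>i<n. e i * (f (x i) + (1 + L)))"
    unfolding sum_subtractf[symmetric] by (rule sum.cong) (simp_all add: algebra_simps)
  also have "\<dots> \<le> 2 * (1 + L) * S + 2 * (1 + L) * S"
  proof -
    have "\<bar>f (x i)\<bar> \<le> 1 + L" if "i < n" for i using f_abs[OF that] \<open>0 \<le> L\<close> by linarith
    then have "\<bar>\<Sum>i<n. e i * (f (x i) + (1 + L))\<bar> \<le> 2 * (1 + L) * S"
      using f by (intro bound) auto
    moreover have "\<bar>\<Sum>i<n. e i * (g (x i) + (1 + L))\<bar> \<le> 2 * (1 + L) * S"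
      using least_squares_isotonic[OF ls] g_abs by (rule bound)
    ultimately show ?thesis by linarith
  qed
  finally show ?thesis by (simp add: algebra_simps)
qed

text \<open>
  Expressing the moments of the noise through exponentials lets the crude bound on the loss
  reuse the moment generating function that also controls the maximum of the noise.
\<close>
lemma power4_le_exp: "(u::real) ^ 4 \<le> 64 * (exp u + exp (- u))"
proof -
  have *: "v ^ 4 \<le> 64 * exp v" if "0 \<le> v" for v :: real
  proof -
    have "(v / 2)\<^sup>2 / 2 \<le> exp (v / 2)"
      using exp_lower_Taylor_quadratic[of "v / 2"] that by simp
    then have "((v / 2)\<^sup>2 / 2)\<^sup>2 \<le> (exp (v / 2))\<^sup>2"
      by (intro power_mono) auto
    also have "(exp (v / 2))\<^sup>2 = exp v"
      by (simp add: power2_eq_square flip: exp_add)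
    finally show ?thesis
      by (simp add: power_divide flip: power_mult)
  qed
  have "u ^ 4 = \<bar>u\<bar> ^ 4" by (simp add: power_even_abs)
  also have "\<dots> \<le> 64 * exp \<bar>u\<bar>" by (rule *) simp
  also have "exp \<bar>u\<bar> \<le> exp u + exp (- u)" by (simp add: abs_if)
  finally show ?thesis by simp
qed

text \<open>
  The bound on the loss for atypical samples. The term \<open>n\<close> is to be multiplied by a small
  probability, and by the choice of the coefficient \<open>256 / n\<^sup>2\<close> the second term has expectation of order
  \<open>1 / n\<close>.
\<close>
lemma least_squares_loss_le_exp_noise:
  assumes "least_squares n x y g" "f \<in> isotonic_funs" "\<And>i. i < n \<Longrightarrow> y i = f (x i) + e i" "0 < n"
  shows "(\<Sum>i<n. (g (x i) - f (x i))\<^sup>2) / real n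
    \<le> real n + 256 / (real n)\<^sup>2 * (\<Sum>i<n. exp (e i) + exp (- e i))"
proof -
  have "4 * (e i)\<^sup>2 / real n \<le> 1 + 256 / (real n)\<^sup>2 * (exp (e i) + exp (- e i))" for i
  proof -
    have "4 * (e i)\<^sup>2 / real n \<le> 1 + 4 / (real n)\<^sup>2 * e i ^ 4"
      \<comment> \<open>The inequality of arithmetic and geometric means for \<open>1\<close> and \<open>4 * e i ^ 4 / n\<^sup>2\<close>.\<close>
      using zero_le_power2[of "1 - 2 * (e i)\<^sup>2 / real n"] \<open>0 < n\<close>
      by (simp add: power2_diff power_mult_distrib power_divide flip: power_mult)
    also have "\<dots> \<le> 1 + 4 / (real n)\<^sup>2 * (64 * (exp (e i) + exp (- e i)))"
      by (intro add_left_mono mult_left_mono power4_le_exp) simp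
    finally show ?thesis by simp
  qed
  then have "(\<Sum>i<n. 4 * (e i)\<^sup>2 / real n) \<le> (\<Sum>i<n. 1 + 256 / (real n)\<^sup>2 * (exp (e i) + exp (- e i)))"
    by (intro sum_mono)
  also have "\<dots> = real n + 256 / (real n)\<^sup>2 * (\<Sum>i<n. exp (e i) + exp (- e i))"
    unfolding sum.distrib[of "\<lambda>_. 1"] sum_distrib_left by simp
  finally have "(\<Sum>i<n. 4 * (e i)\<^sup>2 / real n)
      \<le> real n + 256 / (real n)\<^sup>2 * (\<Sum>i<n. exp (e i) + exp (- e i))" .
  moreover have "(\<Sum>i<n. (g (x i) - f (x i))\<^sup>2) / real n \<le> (\<Sum>i<n. 4 * (e i)\<^sup>2 / real n)"
    using least_squares_loss_le_noise[OF assms(1-3)]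
    by (simp add: divide_right_mono flip: sum_distrib_left sum_divide_distrib)
  ultimately show ?thesis
    by (rule order_trans[rotated])
qed


section \<open>Exponential moments of the sample\<close>

lemma prob_space_std_normal: "prob_space std_normal_distribution"
  by (rule prob_space_normal_density) simp

lemma prob_space_design_noise:
  "prob_space P \<Longrightarrow> prob_space (P \<Otimes>\<^sub>M std_normal_distribution)"
  by (intro prob_space_pair prob_space_std_normal)

text \<open>Independence, in the only form in which it enters.\<close>
lemma nn_integral_sample_law_prod:
  fixes g :: "nat \<Rightarrow> (real ^ 'd::finite) \<times> real \<Rightarrow> ennreal"
  assumes "prob_space P"
    and "\<And>i. i < n \<Longrightarrow> g i \<in> borel_measurable (P \<Otimes>\<^sub>M std_normal_distribution)"
  shows "(\<integral>\<^sup>+\<omega>. (\<Prod>i<n. g i (\<omega> i)) \<partial>sample_law n P)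
    = (\<Prod>i<n. \<integral>\<^sup>+z. g i z \<partial>(P \<Otimes>\<^sub>M std_normal_distribution))"
proof -
  interpret PN: prob_space "P \<Otimes>\<^sub>M std_normal_distribution"
    using assms(1) by (rule prob_space_design_noise)
  interpret product_sigma_finite "\<lambda>_. P \<Otimes>\<^sub>M std_normal_distribution" ..
  show ?thesis
    unfolding sample_law_def by (rule product_nn_integral_prod) (use assms in auto)
qed

lemma nn_integral_std_normal_tilt:
  "(\<integral>\<^sup>+e. ennreal (exp (t * e - t\<^sup>2 / 2)) \<partial>std_normal_distribution) = 1"
proof -
  interpret prob_space "density lborel (normal_density t 1)"
    by (rule prob_space_normal_density) simp
  have "std_normal_density e * exp (t * e - t\<^sup>2 / 2) = normal_density t 1 e" for e
    by (simp add: normal_density_def power2_eq_square field_simps flip: exp_add)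
  then have "(\<integral>\<^sup>+e. ennreal (exp (t * e - t\<^sup>2 / 2)) \<partial>std_normal_distribution)
      = (\<integral>\<^sup>+e. ennreal (normal_density t 1 e) \<partial>lborel)"
    by (subst nn_integral_density) (auto simp flip: ennreal_mult')
  also have "\<dots> = 1"
    using emeasure_space_1 by (simp add: emeasure_density)
  finally show ?thesis .
qed

text \<open>
  Given the design, the sum of the noise over \<open>D\<close> is centred normal with variance the number of
  points in \<open>D\<close>. Subtracting \<open>t\<^sup>2 / 2\<close> for each of these points normalises the exponential
  whatever their number is, so that no conditioning on the design is required.
\<close>
lemma nn_integral_sample_law_tilt:
  fixes P :: "(real ^ 'd::finite) measure"
  assumes P: "prob_space P" and [measurable]: "D \<in> sets P"
  shows "(\<integral>\<^sup>+\<omega>. ennreal (exp (\<Sum>i<n. if fst (\<omega> i) \<in> D then t * snd (\<omega> i) - t\<^sup>2 / 2 else 0))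
      \<partial>sample_law n P) = 1"
proof -
  let ?g = "\<lambda>z::(real ^ 'd) \<times> real. ennreal (exp (if fst z \<in> D then t * snd z - t\<^sup>2 / 2 else 0))"
  interpret P: prob_space P by fact
  interpret N: prob_space std_normal_distribution by (rule prob_space_std_normal)
  have [measurable]: "?g \<in> borel_measurable (P \<Otimes>\<^sub>M std_normal_distribution)"
    by measurable
  have "(\<integral>\<^sup>+z. ?g z \<partial>(P \<Otimes>\<^sub>M std_normal_distribution))
      = (\<integral>\<^sup>+x. (\<integral>\<^sup>+e. ?g (x, e) \<partial>std_normal_distribution) \<partial>P)"
    by (rule N.nn_integral_fst[symmetric]) measurable
  also have "\<dots> = (\<integral>\<^sup>+x. 1 \<partial>P)"
  proof (rule nn_integral_cong)
    fix x
    show "(\<integral>\<^sup>+e. ?g (x, e) \<partial>std_normal_distribution) = 1"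
      by (cases "x \<in> D") (simp_all add: nn_integral_std_normal_tilt N.emeasure_space_1 del: space_density)
  qed
  also have "\<dots> = 1"
    by (simp add: P.emeasure_space_1)
  finally have "(\<integral>\<^sup>+\<omega>. (\<Prod>i<n. ?g (\<omega> i)) \<partial>sample_law n P) = 1"
    using P by (subst nn_integral_sample_law_prod) simp_all
  then show ?thesis
    by (simp add: exp_sum prod_ennreal)
qed

text \<open>
  The exponential moment of a binomial count, through \<open>exp 1 \<le> 3\<close> on a single observation and
  \<open>1 + u \<le> exp u\<close>.
\<close>
lemma nn_integral_sample_law_count:
  fixes P :: "(real ^ 'd::finite) measure"
  assumes P: "prob_space P" and [measurable]: "D \<in> sets P"
    and D: "emeasure P D \<le> ennreal p" and "0 \<le> p"
  shows "(\<integral>\<^sup>+\<omega>. ennreal (exp (\<Sum>i<n. if fst (\<omega> i) \<in> D then 1 else 0)) \<partial>sample_law n P)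
    \<le> ennreal (exp (2 * (real n * p)))"
proof -
  let ?g = "\<lambda>z::(real ^ 'd) \<times> real. ennreal (exp (if fst z \<in> D then 1 else 0))"
  interpret P: prob_space P by fact
  interpret N: prob_space std_normal_distribution by (rule prob_space_std_normal)
  have [measurable]: "?g \<in> borel_measurable (P \<Otimes>\<^sub>M std_normal_distribution)"
    by measurable
  have "(\<integral>\<^sup>+z. ?g z \<partial>(P \<Otimes>\<^sub>M std_normal_distribution))
      = (\<integral>\<^sup>+x. (\<integral>\<^sup>+e. ?g (x, e) \<partial>std_normal_distribution) \<partial>P)"
    by (rule N.nn_integral_fst[symmetric]) measurable
  also have "\<dots> = (\<integral>\<^sup>+x. ennreal (exp (if x \<in> D then 1 else 0)) \<partial>P)"
    by (simp add: N.emeasure_space_1 del: space_density)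
  also have "\<dots> \<le> (\<integral>\<^sup>+x. 1 + 2 * indicator D x \<partial>P)"
  proof (rule nn_integral_mono)
    fix x
    have "ennreal (exp 1) \<le> ennreal (1 + 2)" using exp_le by (intro ennreal_leI) simp
    then show "ennreal (exp (if x \<in> D then 1 else 0)) \<le> 1 + 2 * indicator D x"
      by (simp add: indicator_def)
  qed
  also have "\<dots> = 1 + 2 * emeasure P D"
    by (subst nn_integral_add) (auto simp: nn_integral_cmult P.emeasure_space_1)
  also have "\<dots> \<le> 1 + 2 * ennreal p"
    using D by (intro add_left_mono mult_left_mono) auto
  also have "\<dots> = ennreal (1 + 2 * p)"
    using \<open>0 \<le> p\<close> by (simp add: ennreal_plus ennreal_mult')
  also have "\<dots> \<le> ennreal (exp (2 * p))"
    by (intro ennreal_leI exp_ge_add_one_self)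
  finally have g: "(\<integral>\<^sup>+z. ?g z \<partial>(P \<Otimes>\<^sub>M std_normal_distribution)) \<le> ennreal (exp (2 * p))" .
  have "(\<integral>\<^sup>+\<omega>. ennreal (exp (\<Sum>i<n. if fst (\<omega> i) \<in> D then 1 else 0)) \<partial>sample_law n P)
      = (\<integral>\<^sup>+\<omega>. (\<Prod>i<n. ?g (\<omega> i)) \<partial>sample_law n P)"
    by (simp add: exp_sum prod_ennreal)
  also have "\<dots> = (\<Prod>i<n. \<integral>\<^sup>+z. ?g z \<partial>(P \<Otimes>\<^sub>M std_normal_distribution))"
    using P by (intro nn_integral_sample_law_prod) simp_all
  also have "\<dots> \<le> (\<Prod>i<n. ennreal (exp (2 * p)))"
    using power_mono[OF g, of n] by simp
  also have "\<dots> = ennreal (exp (2 * (real n * p)))"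
    by (simp add: ennreal_power algebra_simps flip: exp_of_nat_mult)
  finally show ?thesis .
qed

lemma nn_integral_sample_law_noise_mgf:
  fixes P :: "(real ^ 'd::finite) measure"
  assumes P: "prob_space P" and "j < n"
  shows "(\<integral>\<^sup>+\<omega>. ennreal (exp (t * snd (\<omega> j))) \<partial>sample_law n P) = ennreal (exp (t\<^sup>2 / 2))"
proof -
  let ?g = "\<lambda>i (z::(real ^ 'd) \<times> real). if i = j then ennreal (exp (t * snd z)) else 1"
  interpret P: prob_space P by fact
  interpret N: prob_space std_normal_distribution by (rule prob_space_std_normal)
  interpret PN: prob_space "P \<Otimes>\<^sub>M std_normal_distribution"
    using P by (rule prob_space_design_noise)
  have "ennreal (exp (t * e)) = ennreal (exp (t\<^sup>2 / 2)) * ennreal (exp (t * e - t\<^sup>2 / 2))" for e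
    by (simp flip: ennreal_mult' exp_add)
  then have N: "(\<integral>\<^sup>+e. ennreal (exp (t * e)) \<partial>std_normal_distribution) = ennreal (exp (t\<^sup>2 / 2))"
    by (simp add: nn_integral_cmult nn_integral_std_normal_tilt)
  have "(\<integral>\<^sup>+z. ennreal (exp (t * snd z)) \<partial>(P \<Otimes>\<^sub>M std_normal_distribution))
      = (\<integral>\<^sup>+x. (\<integral>\<^sup>+e. ennreal (exp (t * snd (x, e))) \<partial>std_normal_distribution) \<partial>P)"
    by (rule N.nn_integral_fst[symmetric]) measurable
  also have "\<dots> = ennreal (exp (t\<^sup>2 / 2))"
    by (simp add: N P.emeasure_space_1)
  finally have g: "(\<integral>\<^sup>+z. ?g i z \<partial>(P \<Otimes>\<^sub>M std_normal_distribution))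
      = (if i = j then ennreal (exp (t\<^sup>2 / 2)) else 1)" for i
    by (simp add: PN.emeasure_space_1)
  have "(\<integral>\<^sup>+\<omega>. ennreal (exp (t * snd (\<omega> j))) \<partial>sample_law n P)
      = (\<integral>\<^sup>+\<omega>. (\<Prod>i<n. ?g i (\<omega> i)) \<partial>sample_law n P)"
    using \<open>j < n\<close> by (simp add: prod.delta)
  also have "\<dots> = (\<Prod>i<n. \<integral>\<^sup>+z. ?g i z \<partial>(P \<Otimes>\<^sub>M std_normal_distribution))"
    using P by (intro nn_integral_sample_law_prod) simp_all
  also have "\<dots> = ennreal (exp (t\<^sup>2 / 2))"
    unfolding g using \<open>j < n\<close> by (simp add: prod.delta)
  finally show ?thesis .
qed

lemma cell_event_borel:
  fixes B :: "('d::finite \<Rightarrow> nat) set"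
  assumes "finite B"
  shows "{x. cell k x \<in> B} \<in> sets borel"
proof -
  have [measurable]: "(\<lambda>x::real ^ 'd. x $ j) \<in> borel_measurable borel" for j
    by (intro borel_measurable_continuous_onI continuous_intros)
  have "{x :: real ^ 'd. \<forall>j\<in>UNIV. nat \<lfloor>2 ^ k * x $ j\<rfloor> = c j} \<in> sets borel" for c :: "'d \<Rightarrow> nat"
    by measurable
  then have "(\<Union>c\<in>B. {x :: real ^ 'd. \<forall>j\<in>UNIV. nat \<lfloor>2 ^ k * x $ j\<rfloor> = c j}) \<in> sets borel"
    using \<open>finite B\<close> by (intro sets.finite_UN) auto
  also have "(\<Union>c\<in>B. {x :: real ^ 'd. \<forall>j\<in>UNIV. nat \<lfloor>2 ^ k * x $ j\<rfloor> = c j}) = (\<Union>c\<in>B. {x. cell k x = c})"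
    by (simp add: cell_def fun_eq_iff)
  also have "\<dots> = {x. cell k x \<in> B}"
    by blast
  finally show ?thesis .
qed

lemma bounded_designD:
  fixes P :: "(real ^ 'd::finite) measure"
  assumes "bounded_design m M P"
  shows "prob_space P" "sets P = sets borel" "AE x in P. x \<in> {0..1}"
  using assms by (auto simp: bounded_design_def AE_density indicator_def simp del: atLeastAtMost_iff)

text \<open>Inside the cube a cell lies in a closed box of side \<open>2 powr - k\<close>, and the density is at most \<open>M\<close>.\<close>
lemma emeasure_cell_le:
  fixes P :: "(real ^ 'd::finite) measure"
  assumes P: "bounded_design m M P" and "0 \<le> M"
  shows "emeasure P {x. cell k x = c} \<le> ennreal (M / 2 ^ (k * CARD('d)))"
proof -
  obtain p where p: "p \<in> borel_measurable lborel"
      "P = density lborel (\<lambda>x. ennreal (p x) * indicator {0..1} x)" "\<And>x. x \<in> {0..1} \<Longrightarrow> p x \<le> M"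
    using P by (auto simp: bounded_design_def)
  define a b where "a = (\<chi> j. real (c j) / 2 ^ k)" and "b = (\<chi> j. (real (c j) + 1) / 2 ^ k)"
  have ab: "a $ j \<le> b $ j" for j
    by (simp add: a_def b_def divide_right_mono)
  have sub: "x \<in> cbox a b" if "x \<in> {0..1}" "cell k x = c" for x
  proof -
    have "real (c j) \<le> 2 ^ k * x $ j \<and> 2 ^ k * x $ j \<le> real (c j) + 1" for j
    proof -
      have "0 \<le> 2 ^ k * x $ j" using that(1) unfolding cube_iff by simp
      then have "real (c j) = real_of_int \<lfloor>2 ^ k * x $ j\<rfloor>"
        using that(2) by (auto simp: cell_def)
      then show ?thesis by linarith
    qed
    then show ?thesis
      by (simp add: mem_box_cart a_def b_def field_simps)
  qed
  have [measurable]: "{x. cell k x = c} \<in> sets borel"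
    using cell_event_borel[of "{c}" k] by simp
  have [measurable]: "p \<in> borel_measurable borel" using p(1) by simp
  have "emeasure P {x. cell k x = c}
      = (\<integral>\<^sup>+x. ennreal (p x) * indicator {0..1} x * indicator {x. cell k x = c} x \<partial>lborel)"
    unfolding p(2) by (subst emeasure_density) auto
  also have "\<dots> \<le> (\<integral>\<^sup>+x. ennreal M * indicator (cbox a b) x \<partial>lborel)"
    using p(3) sub by (intro nn_integral_mono) (auto simp: indicator_def intro!: ennreal_leI)
  also have "\<dots> = ennreal M * emeasure lborel (cbox a b)"
    by (subst nn_integral_cmult) auto
  also have "emeasure lborel (cbox a b) = ennreal (measure lborel (cbox a b))"
    by (rule emeasure_eq_ennreal_measure) (simp add: emeasure_lborel_cbox_eq)
  also have "measure lborel (cbox a b) = (\<Prod>j\<in>UNIV. b $ j - a $ j)"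
    using ab by (intro content_cbox_cart) (auto simp: interval_ne_empty_cart)
  also have "\<dots> = (\<Prod>j\<in>(UNIV::'d set). 1 / 2 ^ k)"
    by (simp add: a_def b_def diff_divide_distrib[symmetric])
  also have "\<dots> = 1 / 2 ^ (k * CARD('d))"
    by (simp add: power_mult power_divide)
  finally show ?thesis
    using \<open>0 \<le> M\<close> by (simp flip: ennreal_mult')
qed

lemma AE_sample_in_cube:
  fixes P :: "(real ^ 'd::finite) measure"
  assumes "bounded_design m M P"
  shows "AE \<omega> in sample_law n P. \<forall>i<n. fst (\<omega> i) \<in> {0..1}"
proof -
  note P = bounded_designD[OF assms]
  interpret N: prob_space std_normal_distribution by (rule prob_space_std_normal)
  have "AE z in P \<Otimes>\<^sub>M std_normal_distribution. fst z \<in> {0..1}"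
  proof (rule AE_distrD[where M' = P and f = fst and P = "\<lambda>x. x \<in> {0..1}"])
    show "fst \<in> measurable (P \<Otimes>\<^sub>M std_normal_distribution) P" by simp
    show "AE x in distr (P \<Otimes>\<^sub>M std_normal_distribution) P fst. x \<in> {0..1}"
      using P(3) unfolding N.distr_pair_fst .
  qed
  then have "AE \<omega> in sample_law n P. fst (\<omega> i) \<in> {0..1}" if "i < n" for i
    unfolding sample_law_def using that prob_space_design_noise[OF P(1)]
    by (intro AE_PiM_component) auto
  then have "AE \<omega> in sample_law n P. \<forall>i\<in>{..<n}. fst (\<omega> i) \<in> {0..1}"
    by (intro AE_finite_allI) auto
  then show ?thesis
    by (simp add: Ball_def)
qed


section \<open>Exponential penalties for atypical samples\<close>

text \<open>
  A union bound without events: when the sum of the exponentials is less than one, every exponent is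
  negative.
\<close>
lemma sum_ennreal_exp_less_one:
  assumes "(\<Sum>a\<in>A. ennreal (exp (g a))) < 1" "finite A" "a \<in> A"
  shows "g a < 0"
proof -
  have "ennreal (exp (g a)) \<le> (\<Sum>a\<in>A. ennreal (exp (g a)))"
    using assms(2,3) by (intro member_le_sum) auto
  then have "ennreal (exp (g a)) < 1" using assms(1) by (rule le_less_trans)
  then show ?thesis by simp
qed

lemma measurable_sample_point [measurable]:
  "i < n \<Longrightarrow> (\<lambda>\<omega>. \<omega> i) \<in> measurable (sample_law n P) (P \<Otimes>\<^sub>M std_normal_distribution)"
  unfolding sample_law_def by (rule measurable_component_singleton) simp

lemma measurable_noise:
  assumes "i < n" shows "(\<lambda>\<omega>. snd (\<omega> i)) \<in> borel_measurable (sample_law n P)"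
  using measurable_compose[OF measurable_sample_point[OF assms] measurable_snd] by simp

lemma measurable_region_sum:
  fixes \<phi> :: "real \<Rightarrow> real"
  assumes [measurable]: "D \<in> sets P" "\<phi> \<in> borel_measurable borel"
  shows "(\<lambda>\<omega>. \<Sum>i<n. if fst (\<omega> i) \<in> D then \<phi> (snd (\<omega> i)) else 0) \<in> borel_measurable (sample_law n P)"
proof (rule borel_measurable_sum)
  fix i assume "i \<in> {..<n}"
  then have "i < n" by simp
  have [measurable]: "(\<lambda>\<omega>. fst (\<omega> i)) \<in> measurable (sample_law n P) P"
    by (rule measurable_compose[OF measurable_sample_point[OF \<open>i < n\<close>] measurable_fst])
  note [measurable] = measurable_noise[OF \<open>i < n\<close>, of P]
  show "(\<lambda>\<omega>. if fst (\<omega> i) \<in> D then \<phi> (snd (\<omega> i)) else 0) \<in> borel_measurable (sample_law n P)"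
    by measurable
qed

lemma nn_integral_exp_diff:
  assumes "h \<in> borel_measurable M"
  shows "(\<integral>\<^sup>+\<omega>. ennreal (exp (h \<omega> - c)) \<partial>M) = ennreal (exp (- c)) * (\<integral>\<^sup>+\<omega>. ennreal (exp (h \<omega>)) \<partial>M)"
proof -
  have "ennreal (exp (h \<omega> - c)) = ennreal (exp (- c)) * ennreal (exp (h \<omega>))" for \<omega>
    by (simp flip: ennreal_mult' exp_add)
  then show ?thesis using assms by (simp add: nn_integral_cmult)
qed

definition increment_region :: "nat \<Rightarrow> ('d::finite \<Rightarrow> nat) set \<Rightarrow> ('d \<Rightarrow> nat) set \<Rightarrow> (real ^ 'd) set" where
  "increment_region k B B' = {x. cell k x \<in> B \<and> cell (k + 1) x \<notin> B'}"

text \<open>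
  The links between consecutive levels, with a sign: both signs of the noise sum have to be controlled.
\<close>
definition increments :: "nat \<Rightarrow> (nat \<times> ('d::finite \<Rightarrow> nat) set \<times> ('d \<Rightarrow> nat) set \<times> real) set" where
  "increments K = (SIGMA k:{..K}. grid_upsets (2 ^ k) \<times> grid_upsets (2 ^ (k + 1)) \<times> {1, - 1})"

text \<open>
  The three penalties are the sums of exponentials belonging to the three requirements on a typical
  sample: no cell of level \<open>K\<close> contains more than \<open>L\<close> design points, no noise variable exceeds \<open>L\<close> in
  absolute value, and the sum of the noise over every link at level \<open>k\<close> satisfies the exponential
  inequality with parameter \<open>\<tau> k\<close> and entropy \<open>w k\<close>. A penalty below one enforces its
  requirement.
\<close>
definition crowding_penalty :: "nat \<Rightarrow> nat \<Rightarrow> real \<Rightarrow> (nat \<Rightarrow> (real ^ 'd::finite) \<times> real) \<Rightarrow> ennreal" where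
  "crowding_penalty n K L \<omega> = (\<Sum>c\<in>grid (2 ^ K). ennreal (exp
     ((\<Sum>i<n. if fst (\<omega> i) \<in> {x. cell K x = c} then 1 else 0) - L)))"

definition noise_penalty :: "nat \<Rightarrow> real \<Rightarrow> (nat \<Rightarrow> (real ^ 'd::finite) \<times> real) \<Rightarrow> ennreal" where
  "noise_penalty n L \<omega> = (\<Sum>(j, \<sigma>)\<in>{..<n} \<times> {1, - 1}. ennreal (exp (\<sigma> * snd (\<omega> j) - L)))"

definition deviation_penalty :: "nat \<Rightarrow> nat \<Rightarrow> (nat \<Rightarrow> real) \<Rightarrow> (nat \<Rightarrow> real)
    \<Rightarrow> (nat \<Rightarrow> (real ^ 'd::finite) \<times> real) \<Rightarrow> ennreal" where
  "deviation_penalty n K \<tau> w \<omega> = (\<Sum>(k, B, B', \<sigma>)\<in>increments K. ennreal (exp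
     ((\<Sum>i<n. if fst (\<omega> i) \<in> increment_region k B B'
        then \<sigma> * \<tau> k * snd (\<omega> i) - (\<sigma> * \<tau> k)\<^sup>2 / 2 else 0) - w k)))"

lemma finite_increments [simp]: "finite (increments K)"
  unfolding increments_def by (intro finite_SigmaI) auto

lemma increment_region_borel:
  assumes "finite B" "finite B'" shows "increment_region k B B' \<in> sets borel"
proof -
  have "increment_region k B B' = {x. cell k x \<in> B} - {x. cell (k + 1) x \<in> B'}"
    by (auto simp: increment_region_def)
  then show ?thesis
    using cell_event_borel[OF assms(1)] cell_event_borel[OF assms(2)] by auto
qed

lemma finite_grid_upset: "B \<in> grid_upsets m \<Longrightarrow> finite B"
  by (rule finite_subset[of _ "grid m"]) (auto simp: grid_upsets_def)

lemma increments_region_borel: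
  "(k, B, B', \<sigma>) \<in> increments K \<Longrightarrow> increment_region k B B' \<in> sets borel"
  by (intro increment_region_borel finite_grid_upset) (auto simp: increments_def)

lemma crowding_penalty_less_one:
  assumes "crowding_penalty n K L \<omega> < 1" "c \<in> grid (2 ^ K)"
  shows "real (card {i. i < n \<and> cell K (fst (\<omega> i)) = c}) \<le> L"
proof -
  have "(\<Sum>i<n. if fst (\<omega> i) \<in> {x. cell K x = c} then 1 else 0) - L < 0"
    using assms unfolding crowding_penalty_def
    by (intro sum_ennreal_exp_less_one[where A = "grid (2 ^ K)" and a = c
        and g = "\<lambda>c. (\<Sum>i<n. if fst (\<omega> i) \<in> {x. cell K x = c} then 1 else 0) - L"]) auto
  moreover have "(\<Sum>i<n. if fst (\<omega> i) \<in> {x. cell K x = c} then 1 else 0)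
      = (\<Sum>i\<in>{i \<in> {..<n}. fst (\<omega> i) \<in> {x. cell K x = c}}. 1 :: real)"
    by (rule sum.inter_filter[symmetric]) simp
  moreover have "{i \<in> {..<n}. fst (\<omega> i) \<in> {x. cell K x = c}} = {i. i < n \<and> cell K (fst (\<omega> i)) = c}"
    by auto
  ultimately show ?thesis
    by simp
qed

lemma noise_penalty_less_one:
  assumes "noise_penalty n L \<omega> < 1" "i < n"
  shows "\<bar>snd (\<omega> i)\<bar> \<le> L"
proof -
  have "\<sigma> * snd (\<omega> i) - L < 0" if "\<sigma> \<in> {1, - 1}" for \<sigma>
    using sum_ennreal_exp_less_one[of "\<lambda>(j, \<sigma>). \<sigma> * snd (\<omega> j) - L" "{..<n} \<times> {1, - 1}" "(i, \<sigma>)"]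
      assms that by (simp add: noise_penalty_def case_prod_unfold)
  from this[of 1] this[of "- 1"] show ?thesis by simp
qed

lemma deviation_penalty_less_one:
  fixes \<omega> :: "nat \<Rightarrow> (real ^ 'd::finite) \<times> real"
  assumes "deviation_penalty n K \<tau> w \<omega> < 1" "k \<le> K" "B \<in> grid_upsets (2 ^ k)" "B' \<in> grid_upsets (2 ^ (k + 1))"
    and "0 < \<tau> k"
  defines "J \<equiv> {i. i < n \<and> cell k (fst (\<omega> i)) \<in> B \<and> cell (k + 1) (fst (\<omega> i)) \<notin> B'}"
  shows "\<bar>\<Sum>i\<in>J. snd (\<omega> i)\<bar> \<le> real (card J) * \<tau> k / 2 + w k / \<tau> k"
proof -
  have J: "J = {i \<in> {..<n}. fst (\<omega> i) \<in> increment_region k B B'}"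
    by (auto simp: J_def increment_region_def)
  let ?g = "\<lambda>(k, B, B', \<sigma>). (\<Sum>i<n. if fst (\<omega> i) \<in> increment_region k B B'
        then \<sigma> * \<tau> k * snd (\<omega> i) - (\<sigma> * \<tau> k)\<^sup>2 / 2 else 0) - w k"
  have sgn: "\<sigma> * \<tau> k * (\<Sum>i\<in>J. snd (\<omega> i)) - real (card J) * (\<tau> k)\<^sup>2 / 2 < w k"
    if \<sigma>: "\<sigma> \<in> {1, - 1}" for \<sigma>
  proof -
    have "?g (k, B, B', \<sigma>) < 0"
      using assms(1-4) \<sigma>
      by (intro sum_ennreal_exp_less_one[of ?g "increments K"])
         (auto simp: deviation_penalty_def case_prod_unfold increments_def)
    moreover have "(\<sigma> * \<tau> k)\<^sup>2 = (\<tau> k)\<^sup>2" using \<sigma> by auto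
    moreover have "(\<Sum>i<n. if fst (\<omega> i) \<in> increment_region k B B'
        then \<sigma> * \<tau> k * snd (\<omega> i) - (\<sigma> * \<tau> k)\<^sup>2 / 2 else 0)
        = (\<Sum>i\<in>J. \<sigma> * \<tau> k * snd (\<omega> i) - (\<sigma> * \<tau> k)\<^sup>2 / 2)"
      unfolding J by (rule sum.inter_filter[symmetric]) simp
    ultimately show ?thesis
      by (simp add: sum_subtractf flip: sum_distrib_left)
  qed
  have "\<tau> k * \<bar>\<Sum>i\<in>J. snd (\<omega> i)\<bar> \<le> real (card J) * (\<tau> k)\<^sup>2 / 2 + w k"
    using sgn[of 1] sgn[of "- 1"] by (simp add: abs_if)
  then show ?thesis
    using \<open>0 < \<tau> k\<close> by (simp add: field_simps power2_eq_square)
qed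

lemma nn_integral_crowding_penalty_le:
  fixes P :: "(real ^ 'd::finite) measure"
  assumes P: "bounded_design m M P" and "0 \<le> M"
  shows "(\<integral>\<^sup>+\<omega>. crowding_penalty n K L \<omega> \<partial>sample_law n P)
    \<le> ennreal (real ((2 ^ K + 1) ^ CARD('d)) * exp (2 * (real n * (M / 2 ^ (K * CARD('d)))) - L))"
proof -
  note PD = bounded_designD[OF P]
  have D: "{x :: real ^ 'd. cell K x = c} \<in> sets P" for c
    using cell_event_borel[of "{c}" K] PD(2) by simp
  have h: "(\<lambda>\<omega>. \<Sum>i<n. if fst (\<omega> i) \<in> {x. cell K x = c} then 1 else 0 :: real)
      \<in> borel_measurable (sample_law n P)" for c
    using measurable_region_sum[OF D[of c], of "\<lambda>_. 1" n] by simp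
  have "(\<integral>\<^sup>+\<omega>. crowding_penalty n K L \<omega> \<partial>sample_law n P) = (\<Sum>c\<in>grid (2 ^ K). ennreal (exp (- L)) *
      (\<integral>\<^sup>+\<omega>. ennreal (exp (\<Sum>i<n. if fst (\<omega> i) \<in> {x. cell K x = c} then 1 else 0)) \<partial>sample_law n P))"
    unfolding crowding_penalty_def
    by (subst nn_integral_sum) (use h in \<open>auto intro!: sum.cong nn_integral_exp_diff simp del: mem_Collect_eq\<close>)
  also have "\<dots> \<le> (\<Sum>c\<in>(grid (2 ^ K) :: ('d \<Rightarrow> nat) set). ennreal (exp (- L)) *
      ennreal (exp (2 * (real n * (M / 2 ^ (K * CARD('d)))))))"
    using P \<open>0 \<le> M\<close> PD(1) D
    by (intro sum_mono mult_left_mono nn_integral_sample_law_count emeasure_cell_le) auto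
  also have "\<dots> = of_nat ((2 ^ K + 1) ^ CARD('d))
      * ennreal (exp (2 * (real n * (M / 2 ^ (K * CARD('d)))) - L))"
    by (simp add: card_grid flip: ennreal_mult' exp_add)
  finally show ?thesis
    by (simp only: ennreal_mult' ennreal_of_nat_eq_real_of_nat of_nat_0_le_iff)
qed

lemma card_signs: "card {1, - 1 :: real} = 2"
  by simp

lemma nn_integral_noise_penalty:
  fixes P :: "(real ^ 'd::finite) measure"
  assumes P: "prob_space P"
  shows "(\<integral>\<^sup>+\<omega>. noise_penalty n L \<omega> \<partial>sample_law n P) = ennreal (2 * real n * exp (1 / 2 - L))"
proof -
  have int: "(\<integral>\<^sup>+\<omega>. ennreal (exp (\<sigma> * snd (\<omega> j) - L)) \<partial>sample_law n P) = ennreal (exp (1 / 2 - L))"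
    if "j < n" "\<sigma> \<in> {1, - 1}" for j \<sigma>
  proof -
    have "\<sigma>\<^sup>2 = 1" using that by auto
    then show ?thesis
      using measurable_noise[OF \<open>j < n\<close>, of P] nn_integral_sample_law_noise_mgf[OF P \<open>j < n\<close>, of \<sigma>]
      by (subst nn_integral_exp_diff) (auto simp flip: ennreal_mult' exp_add)
  qed
  have meas: "(\<lambda>\<omega>. ennreal (exp (\<sigma> * snd (\<omega> j) - L))) \<in> borel_measurable (sample_law n P)"
    if "j < n" for j \<sigma>
    using measurable_noise[OF that, of P] by measurable
  have "(\<integral>\<^sup>+\<omega>. noise_penalty n L \<omega> \<partial>sample_law n P)
      = (\<Sum>p\<in>{..<n} \<times> {1, - 1}. \<integral>\<^sup>+\<omega>. ennreal (exp (snd p * snd (\<omega> (fst p)) - L)) \<partial>sample_law n P)"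
    unfolding noise_penalty_def case_prod_unfold
  proof (rule nn_integral_sum)
    fix p :: "nat \<times> real" assume "p \<in> {..<n} \<times> {1, - 1}"
    then have "fst p < n" by auto
    then show "(\<lambda>\<omega>. ennreal (exp (snd p * snd (\<omega> (fst p)) - L))) \<in> borel_measurable (sample_law n P)"
      by (rule meas)
  qed
  also have "\<dots> = (\<Sum>p\<in>{..<n} \<times> {1, - 1 :: real}. ennreal (exp (1 / 2 - L)))"
  proof (rule sum.cong[OF refl])
    fix p :: "nat \<times> real" assume "p \<in> {..<n} \<times> {1, - 1}"
    then have "fst p < n" "snd p \<in> {1, - 1}" by auto
    then show "(\<integral>\<^sup>+\<omega>. ennreal (exp (snd p * snd (\<omega> (fst p)) - L)) \<partial>sample_law n P)
        = ennreal (exp (1 / 2 - L))"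
      by (rule int)
  qed
  also have "\<dots> = of_nat (2 * n) * ennreal (exp (1 / 2 - L))"
    by (simp only: sum_constant card_cartesian_product card_lessThan card_signs mult.commute)
  also have "\<dots> = ennreal (real (2 * n) * exp (1 / 2 - L))"
    by (simp only: ennreal_mult' ennreal_of_nat_eq_real_of_nat of_nat_0_le_iff)
  finally show ?thesis by simp
qed

text \<open>
  Every tilted exponential has integral one, so the penalty has the expectation of a weighted
  count of links; the weights \<open>exp (- w k)\<close> have to beat the number of links at level \<open>k\<close>.
\<close>
lemma nn_integral_deviation_penalty:
  fixes P :: "(real ^ 'd::finite) measure"
  assumes P: "prob_space P" "sets P = sets borel"
  shows "(\<integral>\<^sup>+\<omega>. deviation_penalty n K \<tau> w \<omega> \<partial>sample_law n P)
    = (\<Sum>k\<le>K. ennreal (2 * real (card (grid_upsets (2 ^ k) :: ('d \<Rightarrow> nat) set set))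
        * real (card (grid_upsets (2 ^ (k + 1)) :: ('d \<Rightarrow> nat) set set)) * exp (- w k)))"
proof -
  let ?h = "\<lambda>(k, B, B', \<sigma>) \<omega>. \<Sum>i<n. if fst (\<omega> i) \<in> increment_region k (B :: ('d \<Rightarrow> nat) set) B'
        then \<sigma> * \<tau> k * snd (\<omega> i) - (\<sigma> * \<tau> k)\<^sup>2 / 2 else 0"
  have h: "?h a \<in> borel_measurable (sample_law n P)"
    and one: "(\<integral>\<^sup>+\<omega>. ennreal (exp (?h a \<omega>)) \<partial>sample_law n P) = 1" if a: "a \<in> increments K" for a
  proof -
    obtain k B B' \<sigma> where a_eq: "a = (k, B, B', \<sigma>)" by (cases a) auto
    have D: "increment_region k B B' \<in> sets P"
      using a unfolding a_eq P(2) by (rule increments_region_borel)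
    show "?h a \<in> borel_measurable (sample_law n P)"
      unfolding a_eq case_prod_conv using D
      by (rule measurable_region_sum[where \<phi> = "\<lambda>e. \<sigma> * \<tau> k * e - (\<sigma> * \<tau> k)\<^sup>2 / 2"]) measurable
    show "(\<integral>\<^sup>+\<omega>. ennreal (exp (?h a \<omega>)) \<partial>sample_law n P) = 1"
      unfolding a_eq case_prod_conv using P(1) D by (rule nn_integral_sample_law_tilt)
  qed
  have dev: "deviation_penalty n K \<tau> w \<omega> = (\<Sum>a\<in>increments K. ennreal (exp (?h a \<omega> - w (fst a))))"
    for \<omega> :: "nat \<Rightarrow> (real ^ 'd) \<times> real"
    by (simp add: deviation_penalty_def case_prod_unfold)
  have "(\<integral>\<^sup>+\<omega>. deviation_penalty n K \<tau> w \<omega> \<partial>sample_law n P)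
      = (\<Sum>a\<in>increments K. \<integral>\<^sup>+\<omega>. ennreal (exp (?h a \<omega> - w (fst a))) \<partial>sample_law n P)"
    unfolding dev
  proof (rule nn_integral_sum)
    fix a :: "nat \<times> ('d \<Rightarrow> nat) set \<times> ('d \<Rightarrow> nat) set \<times> real" assume "a \<in> increments K"
    note [measurable] = h[OF this]
    show "(\<lambda>\<omega>. ennreal (exp (?h a \<omega> - w (fst a)))) \<in> borel_measurable (sample_law n P)"
      by measurable
  qed
  also have "\<dots> = (\<Sum>a\<in>(increments K :: (nat \<times> ('d \<Rightarrow> nat) set \<times> ('d \<Rightarrow> nat) set \<times> real) set).
      ennreal (exp (- w (fst a))))"
    by (intro sum.cong refl) (simp only: nn_integral_exp_diff[OF h] one mult_1_right)
  also have "\<dots> = (\<Sum>k\<le>K. \<Sum>b\<in>(grid_upsets (2 ^ k) :: ('d \<Rightarrow> nat) set set)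
      \<times> (grid_upsets (2 ^ (k + 1)) :: ('d \<Rightarrow> nat) set set) \<times> {1, - 1 :: real}. ennreal (exp (- w k)))"
    unfolding increments_def
    by (subst sum.Sigma) (auto intro!: sum.cong simp: case_prod_unfold)
  also have "\<dots> = (\<Sum>k\<le>K. ennreal (2 * real (card (grid_upsets (2 ^ k) :: ('d \<Rightarrow> nat) set set))
        * real (card (grid_upsets (2 ^ (k + 1)) :: ('d \<Rightarrow> nat) set set)) * exp (- w k)))"
  proof (rule sum.cong[OF refl])
    fix k
    let ?N = "card (grid_upsets (2 ^ k) :: ('d \<Rightarrow> nat) set set) * (card (grid_upsets (2 ^ (k + 1)) :: ('d \<Rightarrow> nat) set set) * 2)"
    have "(\<Sum>b\<in>(grid_upsets (2 ^ k) :: ('d \<Rightarrow> nat) set set)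
      \<times> (grid_upsets (2 ^ (k + 1)) :: ('d \<Rightarrow> nat) set set) \<times> {1, - 1 :: real}. ennreal (exp (- w k)))
      = of_nat ?N * ennreal (exp (- w k))"
      by (simp only: sum_constant card_cartesian_product card_signs)
    also have "\<dots> = ennreal (real ?N * exp (- w k))"
      by (simp only: ennreal_mult' ennreal_of_nat_eq_real_of_nat of_nat_0_le_iff)
    finally show "(\<Sum>b\<in>(grid_upsets (2 ^ k) :: ('d \<Rightarrow> nat) set set)
      \<times> (grid_upsets (2 ^ (k + 1)) :: ('d \<Rightarrow> nat) set set) \<times> {1, - 1 :: real}. ennreal (exp (- w k)))
      = ennreal (2 * real (card (grid_upsets (2 ^ k) :: ('d \<Rightarrow> nat) set set))
        * real (card (grid_upsets (2 ^ (k + 1)) :: ('d \<Rightarrow> nat) set set)) * exp (- w k))"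
      by (simp add: algebra_simps)
  qed
  finally show ?thesis .
qed

lemma noise_penalty_0:
  "noise_penalty n 0 \<omega> = ennreal (\<Sum>i<n. exp (snd (\<omega> i)) + exp (- snd (\<omega> i)))"
proof -
  have "noise_penalty n 0 \<omega> = (\<Sum>j<n. \<Sum>\<sigma>\<in>{1, - 1}. ennreal (exp (\<sigma> * snd (\<omega> j) - 0)))"
    unfolding noise_penalty_def by (rule sum.cartesian_product[symmetric])
  also have "\<dots> = (\<Sum>i<n. ennreal (exp (snd (\<omega> i)) + exp (- snd (\<omega> i))))"
    by simp
  also have "\<dots> = ennreal (\<Sum>i<n. exp (snd (\<omega> i)) + exp (- snd (\<omega> i)))"
    by (rule sum_ennreal) (simp add: add_nonneg_nonneg)
  finally show ?thesis .
qed

lemma borel_measurable_noise_penalty: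
  "noise_penalty n L \<in> borel_measurable (sample_law n P)"
proof -
  have "(\<lambda>\<omega>. ennreal (exp (\<sigma> * snd (\<omega> j) - L))) \<in> borel_measurable (sample_law n P)" if "j < n" for j \<sigma>
    using measurable_noise[OF that, of P] by measurable
  then show ?thesis
    unfolding noise_penalty_def[abs_def] case_prod_unfold
    by (intro borel_measurable_sum) (simp add: mem_Times_iff)
qed

lemma borel_measurable_crowding_penalty:
  fixes P :: "(real ^ 'd::finite) measure"
  assumes "sets P = sets borel"
  shows "crowding_penalty n K L \<in> borel_measurable (sample_law n P)"
proof -
  have "(\<lambda>\<omega>. ennreal (exp ((\<Sum>i<n. if fst (\<omega> i) \<in> {x. cell K x = c} then 1 else 0) - L)))
      \<in> borel_measurable (sample_law n P)" for c
  proof -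
    have "{x :: real ^ 'd. cell K x = c} \<in> sets P"
      using cell_event_borel[of "{c}" K] assms by simp
    then have [measurable]: "(\<lambda>\<omega>. \<Sum>i<n. if fst (\<omega> i) \<in> {x. cell K x = c} then 1 else 0 :: real)
        \<in> borel_measurable (sample_law n P)"
      by (rule measurable_region_sum[where \<phi> = "\<lambda>_. 1"]) simp
    show ?thesis by measurable
  qed
  then show ?thesis
    unfolding crowding_penalty_def[abs_def] by (intro borel_measurable_sum)
qed

lemma borel_measurable_deviation_penalty:
  fixes P :: "(real ^ 'd::finite) measure"
  assumes "sets P = sets borel"
  shows "deviation_penalty n K \<tau> w \<in> borel_measurable (sample_law n P)"
proof -
  have "(\<lambda>\<omega>. ennreal (exp ((\<Sum>i<n. if fst (\<omega> i) \<in> increment_region k B B'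
        then \<sigma> * \<tau> k * snd (\<omega> i) - (\<sigma> * \<tau> k)\<^sup>2 / 2 else 0) - w k)))
      \<in> borel_measurable (sample_law n P)"
    if "(k, B, B', \<sigma>) \<in> increments K" for k \<sigma> and B B' :: "('d \<Rightarrow> nat) set"
  proof -
    have "increment_region k B B' \<in> sets P"
      unfolding assms using that by (rule increments_region_borel)
    then have [measurable]: "(\<lambda>\<omega>. \<Sum>i<n. if fst (\<omega> i) \<in> increment_region k B B'
        then \<sigma> * \<tau> k * snd (\<omega> i) - (\<sigma> * \<tau> k)\<^sup>2 / 2 else 0) \<in> borel_measurable (sample_law n P)"
      by (rule measurable_region_sum[where \<phi> = "\<lambda>e. \<sigma> * \<tau> k * e - (\<sigma> * \<tau> k)\<^sup>2 / 2"]) measurable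
    show ?thesis by measurable
  qed
  then show ?thesis
    unfolding deviation_penalty_def[abs_def] case_prod_unfold
    by (intro borel_measurable_sum) simp
qed


section \<open>The risk bound\<close>

text \<open>
  With \<open>L = 3 * ln n\<close>, every factor \<open>exp (- L)\<close> equals \<open>1 / n ^ 3\<close>, while there are at most
  of order \<open>n\<close> cells, noise variables and levels. The total penalty thus has expectation of order \<open>1 / n\<^sup>2\<close>, small enough to
  be multiplied by \<open>n\<close> for the loss of atypical samples. In \<open>a\<close> the first summand pays for
  the entropy of the links and the second one for this factor \<open>exp (- L)\<close>.
\<close>
lemma risk_le:
  fixes P :: "(real ^ 'd::finite) measure"
  defines "d \<equiv> CARD('d)"
  assumes P: "bounded_design m M P" and "0 \<le> M" and lse: "lse n fhat"
    and f: "f \<in> isotonic_funs \<inter> sup_ball 1"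
    and "d \<ge> 2" "n \<ge> 2" and K: "2 ^ (K * d) \<le> n" "real n \<le> 2 ^ d * 2 ^ (K * d)"
    and L: "L = 3 * ln (real n)" "1 \<le> L" and a: "a = 2 * 4 ^ d * (real K + 3) + L"
    and S: "S = 2 ^ (K * (d - 1)) * ((real K + 1) * (real d * 2 ^ d * L + a) + real d * 2 ^ d * L\<^sup>2)"
  shows "risk n P fhat f \<le> ennreal (8 * (1 + L) * S / real n)
    + ennreal ((2 ^ d * exp (2 * (2 ^ d * M)) + 514 * exp (1 / 2) + 2) / real n)"
proof -
  note PD = bounded_designD[OF P]
  interpret sample: prob_space "sample_law n P"
    unfolding sample_law_def using prob_space_design_noise[OF PD(1)] by (intro prob_space_PiM)
  define \<tau> where "\<tau> k = 1 / sqrt 2 ^ ((K - k) * d)" for k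
  define w where "w k = a * 2 ^ (k * (d - 1))" for k
  define Z :: "(nat \<Rightarrow> (real ^ 'd) \<times> real) \<Rightarrow> ennreal"
    where "Z \<omega> = crowding_penalty n K L \<omega> + noise_penalty n L \<omega> + deviation_penalty n K \<tau> w \<omega>" for \<omega>
  define loss :: "(nat \<Rightarrow> (real ^ 'd) \<times> real) \<Rightarrow> real" where
    "loss \<omega> = (\<Sum>i<n. (fhat (\<lambda>i. fst (\<omega> i)) (\<lambda>i. f (fst (\<omega> i)) + snd (\<omega> i)) (fst (\<omega> i)) - f (fst (\<omega> i)))\<^sup>2) / real n"
    for \<omega>
  have "0 \<le> a" using L(2) by (simp add: a)
  have n0: "0 < real n" using \<open>n \<ge> 2\<close> by simp
  \<comment> \<open>The penalties dominate the loss pointwise: if they are small the sample is typical and the first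
      term suffices, otherwise the crude bound on the loss is at most the rest.\<close>
  have pointwise: "ennreal (loss \<omega>) \<le> ennreal (8 * (1 + L) * S / real n)
      + (ennreal (real n) * Z \<omega> + ennreal (256 / (real n)\<^sup>2) * noise_penalty n 0 \<omega>)"
    if cube: "\<forall>i<n. fst (\<omega> i) \<in> {0..1}" for \<omega>
  proof -
    have ls: "least_squares n (\<lambda>i. fst (\<omega> i)) (\<lambda>i. f (fst (\<omega> i)) + snd (\<omega> i))
        (fhat (\<lambda>i. fst (\<omega> i)) (\<lambda>i. f (fst (\<omega> i)) + snd (\<omega> i)))"
      using lse[unfolded lse_def, THEN spec, THEN spec, THEN mp, OF cube] .
    show ?thesis
    proof (cases "Z \<omega> < 1")
      case True
      have small: "crowding_penalty n K L \<omega> < 1" "noise_penalty n L \<omega> < 1" "deviation_penalty n K \<tau> w \<omega> < 1"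
        using True unfolding Z_def
        by (metis (no_types, lifting) add.commute add_increasing2 le_less_trans order_refl zero_le)+
      have "n * loss \<omega> \<le> 8 * (1 + L) * S"
      proof -
        have "(\<Sum>i<n. (fhat (\<lambda>i. fst (\<omega> i)) (\<lambda>i. f (fst (\<omega> i)) + snd (\<omega> i)) (fst (\<omega> i)) - f (fst (\<omega> i)))\<^sup>2)
            \<le> 8 * (1 + L) * S"
        proof (rule least_squares_loss_le_upper_sums[OF ls f refl])
          show "\<bar>snd (\<omega> i)\<bar> \<le> L" if "i < n" for i
            using small(2) that by (rule noise_penalty_less_one)
          show "\<bar>\<Sum>i\<in>I. snd (\<omega> i)\<bar> \<le> S"
            if I: "I \<subseteq> {..<n}" "\<And>i i'. i \<in> I \<Longrightarrow> i' < n \<Longrightarrow> fst (\<omega> i) \<le> fst (\<omega> i') \<Longrightarrow> i' \<in> I" for I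
            unfolding S d_def
          proof (rule abs_sum_upper_set_le[where x = "\<lambda>i. fst (\<omega> i)" and n = n])
            show "i' \<in> I" if "i \<in> I" "i' < n" "fst (\<omega> i) \<le> fst (\<omega> i')" for i i'
              using that by (rule I(2))
            show "real (card {i. i < n \<and> cell K (fst (\<omega> i)) = c}) \<le> L" if "c \<in> grid (2 ^ K)" for c
              using small(1) that by (rule crowding_penalty_less_one)
            show "\<bar>snd (\<omega> i)\<bar> \<le> L" if "i < n" for i
              using small(2) that by (rule noise_penalty_less_one)
            fix k and B B' :: "('d \<Rightarrow> nat) set"
            assume k: "k \<le> K" "B \<in> grid_upsets (2 ^ k)" "B' \<in> grid_upsets (2 ^ (k + 1))"
            define J where "J = {i. i < n \<and> cell k (fst (\<omega> i)) \<in> B \<and> cell (k + 1) (fst (\<omega> i)) \<notin> B'}"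
            have "\<bar>\<Sum>i\<in>J. snd (\<omega> i)\<bar> \<le> real (card J) * \<tau> k / 2 + w k / \<tau> k"
              unfolding J_def using small(3) k by (rule deviation_penalty_less_one) (simp add: \<tau>_def)
            then show "\<bar>\<Sum>i\<in>{i. i < n \<and> cell k (fst (\<omega> i)) \<in> B \<and> cell (k + 1) (fst (\<omega> i)) \<notin> B'}. snd (\<omega> i)\<bar>
              \<le> real (card {i. i < n \<and> cell k (fst (\<omega> i)) \<in> B \<and> cell (k + 1) (fst (\<omega> i)) \<notin> B'})
                / (2 * sqrt 2 ^ ((K - k) * CARD('d)))
                + a * 2 ^ (k * (CARD('d) - 1)) * sqrt 2 ^ ((K - k) * CARD('d))"
              unfolding J_def[symmetric] by (simp add: \<tau>_def w_def d_def mult.commute)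
          qed (use cube I(1) K(2) L(2) \<open>0 \<le> a\<close> \<open>d \<ge> 2\<close> in \<open>simp_all add: d_def\<close>)
        qed (use cube L(2) in auto)
        then show ?thesis using n0 by (simp add: loss_def)
      qed
      then have "ennreal (loss \<omega>) \<le> ennreal (8 * (1 + L) * S / real n)"
        using n0 by (intro ennreal_leI) (simp add: field_simps)
      then show ?thesis by (rule add_increasing2[rotated]) simp
    next
      case False
      have "loss \<omega> \<le> real n + 256 / (real n)\<^sup>2 * (\<Sum>i<n. exp (snd (\<omega> i)) + exp (- snd (\<omega> i)))"
        unfolding loss_def using f \<open>n \<ge> 2\<close> by (intro least_squares_loss_le_exp_noise[OF ls]) auto
      then have "ennreal (loss \<omega>) \<le> ennreal (real n + 256 / (real n)\<^sup>2 * (\<Sum>i<n. exp (snd (\<omega> i)) + exp (- snd (\<omega> i))))"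
        by (rule ennreal_leI)
      also have "\<dots> = ennreal (real n) * 1 + ennreal (256 / (real n)\<^sup>2) * noise_penalty n 0 \<omega>"
      proof -
        have "ennreal (p + q * s) = ennreal p * 1 + ennreal q * ennreal s" if "0 \<le> p" "0 \<le> q" "0 \<le> s" for p q s
          using that by (simp add: ennreal_mult)
        then show ?thesis
          unfolding noise_penalty_0 by this (auto intro!: sum_nonneg add_nonneg_nonneg)
      qed
      also have "\<dots> \<le> ennreal (real n) * Z \<omega> + ennreal (256 / (real n)\<^sup>2) * noise_penalty n 0 \<omega>"
        using False by (intro add_right_mono mult_left_mono) auto
      finally show ?thesis by (rule add_increasing[rotated]) simp
    qed
  qed
  have [measurable]: "noise_penalty n L' \<in> borel_measurable (sample_law n P)"
      "crowding_penalty n K L \<in> borel_measurable (sample_law n P)"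
      "deviation_penalty n K \<tau> w \<in> borel_measurable (sample_law n P)" for L'
    by (rule borel_measurable_noise_penalty borel_measurable_crowding_penalty[OF PD(2)] borel_measurable_deviation_penalty[OF PD(2)])+
  have [measurable]: "Z \<in> borel_measurable (sample_law n P)"
    unfolding Z_def[abs_def] by measurable
  have exp_L: "exp (- L) = 1 / real n ^ 3"
    using n0 by (simp add: L(1) exp_minus exp_of_nat_mult[of 3 "ln (real n)", simplified] divide_inverse)
  have int_crowding_penalty: "(\<integral>\<^sup>+\<omega>. crowding_penalty n K L \<omega> \<partial>sample_law n P) \<le> ennreal (2 ^ d * exp (2 * (2 ^ d * M)) / (real n)\<^sup>2)"
  proof -
    have "real ((2 ^ K + 1) ^ d) \<le> 2 ^ d * real n"
    proof -
      have "(2 ^ K + 1 :: nat) ^ d \<le> (2 * 2 ^ K) ^ d"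
        by (intro power_mono) simp_all
      then have "(2 ^ K + 1) ^ d \<le> 2 ^ d * (2 :: nat) ^ (K * d)"
        by (simp add: power_mult_distrib power_mult)
      also have "\<dots> \<le> 2 ^ d * n" using K(1) by simp
      finally have "real ((2 ^ K + 1) ^ d) \<le> real (2 ^ d * n)" by (rule of_nat_mono)
      then show ?thesis by simp
    qed
    moreover have "exp (2 * (real n * (M / 2 ^ (K * d))) - L) \<le> exp (2 * (2 ^ d * M)) / real n ^ 3"
    proof -
      have "real n * (M / 2 ^ (K * d)) \<le> 2 ^ d * M"
        using mult_right_mono[OF K(2) \<open>0 \<le> M\<close>] by (simp add: field_simps)
      then have "exp (2 * (real n * (M / 2 ^ (K * d))) - L) \<le> exp (2 * (2 ^ d * M)) * exp (- L)"
        by (simp flip: exp_add)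
      then show ?thesis by (simp add: exp_L)
    qed
    ultimately have "real ((2 ^ K + 1) ^ d) * exp (2 * (real n * (M / 2 ^ (K * d))) - L)
        \<le> (2 ^ d * real n) * (exp (2 * (2 ^ d * M)) / real n ^ 3)"
      by (intro mult_mono) auto
    also have "\<dots> = 2 ^ d * exp (2 * (2 ^ d * M)) / (real n)\<^sup>2"
      using n0 by (simp add: power2_eq_square power3_eq_cube)
    finally show ?thesis
      using nn_integral_crowding_penalty_le[OF P \<open>0 \<le> M\<close>, where K = K and L = L and n = n]
      unfolding d_def[symmetric] by (meson ennreal_leI order_trans)
  qed
  have int_noise: "(\<integral>\<^sup>+\<omega>. noise_penalty n L \<omega> \<partial>sample_law n P) = ennreal (2 * exp (1 / 2) / (real n)\<^sup>2)"
  proof -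
    have "exp (1 / 2 - L) = exp (1 / 2) / real n ^ 3"
      using exp_add[of "1 / 2" "- L"] by (simp add: exp_L)
    then show ?thesis
      using n0 by (simp add: nn_integral_noise_penalty[OF PD(1)] power2_eq_square power3_eq_cube)
  qed
  have int_deviation_penalty: "(\<integral>\<^sup>+\<omega>. deviation_penalty n K \<tau> w \<omega> \<partial>sample_law n P) \<le> ennreal (2 / (real n)\<^sup>2)"
  proof -
    have "2 * real (card (grid_upsets (2 ^ k) :: ('d \<Rightarrow> nat) set set))
        * real (card (grid_upsets (2 ^ (k + 1)) :: ('d \<Rightarrow> nat) set set)) * exp (- w k) \<le> 2 / real n ^ 3"
      if "k \<le> K" for k
    proof -
      have "1 \<le> (2::real) ^ (k * (d - 1))" by simp
      then have "L \<le> L * 2 ^ (k * (d - 1))"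
        using L(2) mult_left_mono[of 1 "2 ^ (k * (d - 1))" L] by simp
      then have "2 * 4 ^ d * (real K + 3) * 2 ^ (k * (d - 1)) - w k \<le> - L"
        by (simp add: w_def a algebra_simps)
      then have weight: "exp (2 * 4 ^ d * (real K + 3) * 2 ^ (k * (d - 1))) * exp (- w k) \<le> 1 / real n ^ 3"
        unfolding exp_L[symmetric] exp_add[symmetric] by simp
      have "real (card (grid_upsets (2 ^ k) :: ('d \<Rightarrow> nat) set set))
          * real (card (grid_upsets (2 ^ (k + 1)) :: ('d \<Rightarrow> nat) set set)) * exp (- w k)
          \<le> exp (2 * 4 ^ d * (real K + 3) * 2 ^ (k * (d - 1))) * exp (- w k)"
        unfolding d_def using that by (intro mult_right_mono card_increment_regions_le_exp) auto
      also note weight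
      finally have "real (card (grid_upsets (2 ^ k) :: ('d \<Rightarrow> nat) set set))
          * real (card (grid_upsets (2 ^ (k + 1)) :: ('d \<Rightarrow> nat) set set)) * exp (- w k) \<le> 1 / real n ^ 3" .
      then show ?thesis by simp
    qed
    then have "(\<integral>\<^sup>+\<omega>. deviation_penalty n K \<tau> w \<omega> \<partial>sample_law n P) \<le> (\<Sum>k\<le>K. ennreal (2 / real n ^ 3))"
      unfolding nn_integral_deviation_penalty[OF PD(1,2)] by (intro sum_mono ennreal_leI) auto
    also have "\<dots> = ennreal (real (K + 1) * (2 / real n ^ 3))"
      by (simp only: sum_constant card_atMost ennreal_mult' ennreal_of_nat_eq_real_of_nat of_nat_0_le_iff Suc_eq_plus1)
    also have "\<dots> \<le> ennreal (real n * (2 / real n ^ 3))"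
    proof -
      have "K + 1 \<le> 2 ^ K" by (simp add: Suc_leI)
      also have "(2::nat) ^ K \<le> 2 ^ (K * d)"
        using \<open>d \<ge> 2\<close> by (intro power_increasing) auto
      finally have "K + 1 \<le> n" using K(1) by linarith
      then show ?thesis by (intro ennreal_leI mult_right_mono of_nat_mono) auto
    qed
    also have "real n * (2 / real n ^ 3) = 2 / (real n)\<^sup>2"
      using n0 by (simp add: power2_eq_square power3_eq_cube)
    finally show ?thesis .
  qed
  have "risk n P fhat f = (\<integral>\<^sup>+\<omega>. ennreal (loss \<omega>) \<partial>sample_law n P)"
    by (simp add: risk_def loss_def Let_def)
  also have "\<dots> \<le> (\<integral>\<^sup>+\<omega>. ennreal (8 * (1 + L) * S / real n)
      + (ennreal (real n) * Z \<omega> + ennreal (256 / (real n)\<^sup>2) * noise_penalty n 0 \<omega>) \<partial>sample_law n P)"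
    using AE_sample_in_cube[OF P, of n] pointwise by (intro nn_integral_mono_AE) auto
  also have "\<dots> = ennreal (8 * (1 + L) * S / real n)
      + (ennreal (real n) * ((\<integral>\<^sup>+\<omega>. crowding_penalty n K L \<omega> \<partial>sample_law n P)
          + (\<integral>\<^sup>+\<omega>. noise_penalty n L \<omega> \<partial>sample_law n P) + (\<integral>\<^sup>+\<omega>. deviation_penalty n K \<tau> w \<omega> \<partial>sample_law n P))
        + ennreal (256 / (real n)\<^sup>2) * (\<integral>\<^sup>+\<omega>. noise_penalty n 0 \<omega> \<partial>sample_law n P))"
    by (simp add: nn_integral_add nn_integral_cmult Z_def sample.emeasure_space_1)
  also have "\<dots> \<le> ennreal (8 * (1 + L) * S / real n)
      + (ennreal (real n) * (ennreal (2 ^ d * exp (2 * (2 ^ d * M)) / (real n)\<^sup>2)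
          + ennreal (2 * exp (1 / 2) / (real n)\<^sup>2) + ennreal (2 / (real n)\<^sup>2))
        + ennreal (256 / (real n)\<^sup>2) * ennreal (2 * real n * exp (1 / 2)))"
    using int_crowding_penalty int_noise int_deviation_penalty nn_integral_noise_penalty[OF PD(1), of n 0]
    by (intro add_mono mult_left_mono order_refl) simp_all
  also have "\<dots> = ennreal (8 * (1 + L) * S / real n)
      + ennreal (real n * (2 ^ d * exp (2 * (2 ^ d * M)) / (real n)\<^sup>2
          + 2 * exp (1 / 2) / (real n)\<^sup>2 + 2 / (real n)\<^sup>2)
        + 256 / (real n)\<^sup>2 * (2 * real n * exp (1 / 2)))"
  proof -
    have "ennreal p * (ennreal q\<^sub>1 + ennreal q\<^sub>2 + ennreal q\<^sub>3) + ennreal s * ennreal t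
        = ennreal (p * (q\<^sub>1 + q\<^sub>2 + q\<^sub>3) + s * t)"
      if "0 \<le> p" "0 \<le> q\<^sub>1" "0 \<le> q\<^sub>2" "0 \<le> q\<^sub>3" "0 \<le> s" "0 \<le> t" for p q\<^sub>1 q\<^sub>2 q\<^sub>3 s t
      using that by (simp add: ennreal_mult)
    then show ?thesis by simp
  qed
  also have "real n * (2 ^ d * exp (2 * (2 ^ d * M)) / (real n)\<^sup>2
          + 2 * exp (1 / 2) / (real n)\<^sup>2 + 2 / (real n)\<^sup>2)
        + 256 / (real n)\<^sup>2 * (2 * real n * exp (1 / 2))
      = (2 ^ d * exp (2 * (2 ^ d * M)) + 514 * exp (1 / 2) + 2) / real n"
    using n0 by (simp add: power2_eq_square field_simps)
  finally show ?thesis .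
qed


section \<open>The rate\<close>

text \<open>
  The logarithms add up as follows: the bound on the estimator contributes one factor \<open>L\<close>, and \<open>S\<close>
  contributes two, either from the number of levels and the entropy or from the occupancy and the
  size of the noise at the finest level. The choice of \<open>K\<close> makes \<open>2 ^ (K * (d - 1)) / n\<close> at most
  \<open>2 * n powr (- 1 / d)\<close>.
\<close>
lemma rate_le:
  fixes n d K :: nat
  assumes "d \<ge> 2" "n \<ge> 2" and K: "2 ^ (K * d) \<le> n" "n < 2 ^ ((K + 1) * d)"
    and L: "L = 3 * ln (real n)" and a: "a = 2 * 4 ^ d * (real K + 3) + L"
    and S: "S = 2 ^ (K * (d - 1)) * ((real K + 1) * (real d * 2 ^ d * L + a) + real d * 2 ^ d * L\<^sup>2)"
  shows "8 * (1 + L) * S / real n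
    \<le> 864 * (3 * (real d * 2 ^ d) + 16 * 4 ^ d + 2) * (real n powr (- 1 / real d) * ln (real n) ^ 3)"
proof -
  define u where "u = real d * 2 ^ d"
  have n0: "0 < real n" using \<open>n \<ge> 2\<close> by simp
  have "ln 2 \<le> ln (real n)" using \<open>n \<ge> 2\<close> by simp
  then have L2: "2 \<le> L" using ln2_ge_two_thirds unfolding L by linarith
  have "real (K * d) * ln 2 \<le> ln (real n)"
  proof -
    have "ln (2 ^ (K * d)) \<le> ln (real n)"
      using K(1) n0 by (subst ln_le_cancel_iff) (simp_all flip: of_nat_le_iff)
    then show ?thesis by (simp add: ln_realpow)
  qed
  moreover have "real K * 1 \<le> real (K * d) * ln 2"
  proof -
    have "1 \<le> real d * ln 2"
      using mult_mono[of 2 "real d" "2 / 3" "ln (2::real)"] \<open>d \<ge> 2\<close> ln2_ge_two_thirds by simp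
    then have "real K * 1 \<le> real K * (real d * ln 2)" by (intro mult_left_mono) auto
    then show ?thesis by (simp add: mult.assoc)
  qed
  ultimately have KL: "real K \<le> L / 3" unfolding L by simp
  have a_le: "a \<le> (8 * 4 ^ d + 1) * L"
  proof -
    have "2 * 4 ^ d * (real K + 3) \<le> 2 * 4 ^ d * (4 * L)"
      using KL L2 by (intro mult_left_mono) auto
    then show ?thesis by (simp add: a algebra_simps)
  qed
  have u0: "0 \<le> u" by (simp add: u_def)
  have "(real K + 1) * (u * L + a) \<le> (2 * L) * (u * L + (8 * 4 ^ d + 1) * L)"
    using KL L2 a_le u0 by (intro mult_mono add_left_mono add_nonneg_nonneg) (auto simp: a)
  then have "(real K + 1) * (u * L + a) + u * L\<^sup>2 \<le> (3 * u + 16 * 4 ^ d + 2) * L\<^sup>2"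
    by (simp add: power2_eq_square algebra_simps)
  then have S_le: "S \<le> 2 ^ (K * (d - 1)) * ((3 * u + 16 * 4 ^ d + 2) * L\<^sup>2)"
    unfolding S u_def[symmetric] by (intro mult_left_mono) auto
  have scale: "2 ^ (K * (d - 1)) / real n \<le> 2 * real n powr (- 1 / real d)"
  proof -
    have "K * (d - 1) + K = K * d" using \<open>d \<ge> 2\<close> by (cases d) simp_all
    then have "(2::real) ^ (K * (d - 1)) * 2 ^ K = 2 ^ (K * d)" by (simp flip: power_add)
    also have "\<dots> \<le> real n" using K(1) by (simp flip: of_nat_le_iff)
    finally have 1: "2 ^ (K * (d - 1)) / real n \<le> 1 / 2 ^ K"
      using n0 by (simp add: field_simps)
    have "real n \<le> (2 ^ (K + 1)) ^ d"
    proof -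
      have "real n \<le> real (2 ^ ((K + 1) * d))" using K(2) by (intro of_nat_mono) simp
      then show ?thesis by (simp only: of_nat_power of_nat_numeral power_mult)
    qed
    then have "real n powr (1 / real d) \<le> ((2 ^ (K + 1)) ^ d) powr (1 / real d)"
      using n0 by (intro powr_mono2) auto
    also have "\<dots> = 2 ^ (K + 1)"
      using \<open>d \<ge> 2\<close> by (simp add: powr_powr flip: powr_realpow del: power_Suc)
    finally have "1 / 2 ^ (K + 1) \<le> 1 / real n powr (1 / real d)"
      using n0 by (intro divide_left_mono) auto
    also have "\<dots> = real n powr (- 1 / real d)"
      using powr_minus_divide[of "real n" "1 / real d"] by simp
    finally show ?thesis using 1 by simp
  qed
  have "8 * (1 + L) * S / real n \<le> 8 * (2 * L) * (2 ^ (K * (d - 1)) * ((3 * u + 16 * 4 ^ d + 2) * L\<^sup>2)) / real n"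
    using L2 S_le n0 u0 by (intro divide_right_mono mult_mono) (auto simp: S u_def a)
  also have "\<dots> = (16 * (3 * u + 16 * 4 ^ d + 2) * L ^ 3) * (2 ^ (K * (d - 1)) / real n)"
    by (simp add: power2_eq_square power3_eq_cube)
  also have "\<dots> \<le> (16 * (3 * u + 16 * 4 ^ d + 2) * L ^ 3) * (2 * real n powr (- 1 / real d))"
    using scale L2 u0 by (intro mult_left_mono) auto
  also have "(16 * c * L ^ 3) * (2 * r) = 864 * c * (r * ln (real n) ^ 3)" for c r :: real
    by (simp add: L power_mult_distrib)
  finally show ?thesis
    by (simp add: u_def)
qed

text \<open>
  As \<open>ln n\<close> may be smaller than one, raising its exponent costs a constant, which is worst at \<open>n = 2\<close>.
\<close>
lemma log_power_le:
  fixes \<gamma> :: real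
  assumes "n \<ge> (2::nat)" "real j \<le> \<gamma>"
  shows "ln (real n) ^ j \<le> ln 2 powr (real j - \<gamma>) * ln (real n) powr \<gamma>"
proof -
  have pos: "0 < ln (real n)" using assms by simp
  have "ln (real n) ^ j = ln (real n) powr (real j - \<gamma>) * ln (real n) powr \<gamma>"
    using pos by (simp add: powr_realpow flip: powr_add)
  also have "\<dots> \<le> ln 2 powr (real j - \<gamma>) * ln (real n) powr \<gamma>"
    using assms by (intro mult_right_mono powr_mono2') auto
  finally show ?thesis .
qed

theorem theorem4:
  fixes m\<^sub>0 M\<^sub>0 :: real
  assumes "CARD('d::finite) \<ge> 2" and "0 < m\<^sub>0" and "m\<^sub>0 \<le> M\<^sub>0"
  shows "\<exists>C>0. \<forall>n\<ge>2. \<forall>(P :: (real ^ 'd) measure) fhat.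
    bounded_design m\<^sub>0 M\<^sub>0 P \<longrightarrow> lse n fhat \<longrightarrow>
    (SUP f\<^sub>0\<in>isotonic_funs \<inter> sup_ball 1. risk n P fhat f\<^sub>0)
      \<le> ennreal (C * real n powr (- 1 / real CARD('d)) * ln (real n) powr log_exponent CARD('d))"
proof -
  define d where "d = CARD('d)"
  define \<gamma> where "\<gamma> = log_exponent d"
  \<comment> \<open>\<open>A\<close> is the constant of the bound on typical samples and \<open>B\<close>, divided by \<open>n\<close>, the contribution of
      the atypical ones.\<close>
  define A where "A = 864 * (3 * (real d * 2 ^ d) + 16 * 4 ^ d + 2)"
  define B where "B = 2 ^ d * exp (2 * (2 ^ d * M\<^sub>0)) + 514 * exp (1 / 2) + 2"
  define C where "C = A * ln 2 powr (real 3 - \<gamma>) + B * ln 2 powr (real 0 - \<gamma>)"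
  have d2: "d \<ge> 2" using assms(1) by (simp add: d_def)
  have "3 \<le> \<gamma>"
  proof (cases "d = 2")
    case False
    then have "3 ^ 2 \<le> real d ^ 2" "3 \<le> real d" using d2 by (intro power_mono, auto)
    then show ?thesis using False by (simp add: \<gamma>_def log_exponent_def)
  qed (simp add: \<gamma>_def log_exponent_def)
  have "0 < A" "0 < B" by (auto simp: A_def B_def intro!: add_pos_pos add_nonneg_pos)
  then have "0 < C" by (auto simp: C_def intro!: add_pos_pos)
  moreover have "risk n P fhat f \<le> ennreal (C * real n powr (- 1 / real d) * ln (real n) powr \<gamma>)"
    if n: "n \<ge> 2" and P: "bounded_design m\<^sub>0 M\<^sub>0 P" and fhat: "lse n fhat"
      and f: "f \<in> isotonic_funs \<inter> sup_ball 1"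
    for n f and P :: "(real ^ 'd) measure" and fhat
  proof -
    define r where "r = real n powr (- 1 / real d)"
    define l where "l = ln (real n)"
    have "(2::nat) \<le> 2 ^ d" using d2 self_le_power[of "2::nat" d] by simp
    then obtain K where K: "(2 ^ d) ^ K \<le> n" "n < (2 ^ d) ^ (K + 1)"
      using ex_power_ivl1[of "2 ^ d" n] n by auto
    have K1: "2 ^ (K * d) \<le> n" "n < 2 ^ ((K + 1) * d)"
      using K by (simp_all only: mult.commute[of _ d] power_mult)
    have K2: "real n \<le> 2 ^ d * 2 ^ (K * d)"
    proof -
      have "real n \<le> real (2 ^ ((K + 1) * d))" using K1(2) by (intro of_nat_mono) simp
      then show ?thesis by (simp add: add_mult_distrib power_add)
    qed
    have "2 / 3 \<le> ln (real n)"
      using n ln2_ge_two_thirds ln_le_cancel_iff[of 2 "real n"] by linarith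
    then have L1: "1 \<le> 3 * ln (real n)" by simp
    define a where "a = 2 * 4 ^ d * (real K + 3) + 3 * ln (real n)"
    define S where "S = 2 ^ (K * (d - 1)) * ((real K + 1) * (real d * 2 ^ d * (3 * ln (real n)) + a)
        + real d * 2 ^ d * (3 * ln (real n))\<^sup>2)"
    have "risk n P fhat f \<le> ennreal (8 * (1 + 3 * ln (real n)) * S / real n) + ennreal (B / real n)"
      unfolding B_def d_def
      using assms(2,3) d2 K1(1) K2 n L1
      by (intro risk_le[OF P _ fhat f, where K = K and a = a]) (simp_all add: a_def S_def d_def)
    also have "\<dots> \<le> ennreal (A * ln 2 powr (real 3 - \<gamma>) * r * l powr \<gamma>) + ennreal (B * ln 2 powr (real 0 - \<gamma>) * r * l powr \<gamma>)"
    proof (intro add_mono ennreal_leI)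
      have "8 * (1 + 3 * ln (real n)) * S / real n \<le> A * (r * l ^ 3)"
        unfolding A_def r_def l_def using rate_le[OF d2 n K1 refl a_def S_def] .
      also have "\<dots> \<le> A * (r * (ln 2 powr (real 3 - \<gamma>) * l powr \<gamma>))"
        unfolding l_def r_def using log_power_le[OF n, of 3 \<gamma>] \<open>3 \<le> \<gamma>\<close> \<open>0 < A\<close>
        by (intro mult_left_mono) auto
      finally show "8 * (1 + 3 * ln (real n)) * S / real n \<le> A * ln 2 powr (real 3 - \<gamma>) * r * l powr \<gamma>"
        by (simp add: mult_ac)
      have "1 / real n \<le> r"
      proof -
        have "real n powr (- 1) \<le> r"
          unfolding r_def using n d2 by (intro powr_mono) (auto simp: field_simps)
        then show ?thesis using n by (simp add: powr_minus_divide)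
      qed
      moreover have "1 \<le> ln 2 powr (real 0 - \<gamma>) * l powr \<gamma>"
        unfolding l_def using log_power_le[OF n, of 0 \<gamma>] \<open>3 \<le> \<gamma>\<close> by simp
      ultimately have "B * (1 / real n * 1) \<le> B * (r * (ln 2 powr (real 0 - \<gamma>) * l powr \<gamma>))"
        using \<open>0 < B\<close> by (intro mult_left_mono mult_mono) (auto simp: r_def)
      then show "B / real n \<le> B * ln 2 powr (real 0 - \<gamma>) * r * l powr \<gamma>"
        by (simp add: mult_ac)
    qed
    also have "\<dots> = ennreal (C * r * l powr \<gamma>)"
      using \<open>0 < A\<close> \<open>0 < B\<close> unfolding C_def
      by (subst ennreal_plus[symmetric]) (auto simp: r_def algebra_simps)
    finally show ?thesis by (simp add: r_def l_def)
  qed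
  ultimately show ?thesis
    unfolding d_def[symmetric] \<gamma>_def[symmetric]
    by (intro exI[of _ C]) (auto intro!: SUP_least)
qed

end
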